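(* Let $(X,d,\mu)$ be a space of homogeneous type in the sense of Coifman–Weiss. For any $f\in\mathrm{BMO}(X)$ there exists a sequence $\{f_j\}_{j=1}^\infty$ of bounded, continuous and boundedly supported functions on $X$ such that $$\|f_j\|_{\mathrm{BMO}(X)}\le a_1\|f\|_{\mathrm{BMO}(X)},$$ $$|f_j(x)|\le a_2\,\mathbb{M}f(x),\quad x\in X,$$ $$\lim_{j\to\infty}f_j(x)=f(x)\quad\text{for a.e. }x\in X,$$ where $a_1$ and $a_2$ are independent of $f$, and $\mathbb{M}$ is the restricted centered Hardy–Littlewood maximal function $$\mathbb{M}f(x)=\sup_{0<r<1}\frac{1}{\mu(B(x,r))}\int_{B(x,r)}|f(y)|\,d\mu(y).$$
   Context: A space of homogeneous type $(X,d,\mu)$ is a topological space $X$ with a Borel measure $\mu$ and a quasi-metric $d$ satisfying: (a) $d(x,y)=d(y,x)$; (b) $d(x,y)>0$ if and only if $x\ne y$; (c) there is a constant $K$ such that $d(x,y)\le K[d(x,z)+d(z,y)]$ for all $x,y,z\in X$; (d) the balls $B(x,r)=\{y\in X:d(x,y)<r\}$, $r>0$, form a basis of open neighborhoods of $x$, and $\mu(B(x,r))>0$ for $r>0$; and the doubling condition: there is a positive constant $A$ with $\mu(B(x,2r))\le A\,\mu(B(x,r))$ for all $x\in X$, $r>0$ (balls have finite measure). $\mathrm{BMO}(X)$ is the space of locally integrable $f$ with $\|f\|_{\mathrm{BMO}(X)}=\sup_B\frac{1}{\mu(B)}\int_B|f-f_B|\,d\mu<\infty$, the supremum over all balls $B$,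 where $f_B=\frac{1}{\mu(B)}\int_Bf\,d\mu$. Boundedly supported means vanishing outside some ball.
   Formalization: The formal theorem excludes f that equal a nonzero constant a.e. when X is not itself a ball; there the claim fails (X = R, f = 1: the seminorm of f is 0, so each f_j is constant and boundedly supported, hence 0). *)

theory Defs
  imports "HOL-Analysis.Analysis"
begin

definition qball :: "('a \<Rightarrow> 'a \<Rightarrow> real) \<Rightarrow> 'a \<Rightarrow> real \<Rightarrow> 'a set"
  where "qball d x r = {y. d x y < r}"

text \<open>
  Spaces of homogeneous type in the sense of Coifman and Weiss. The space is the whole type
  \<open>'a\<close>. No relation between its topology and \<open>d\<close> is assumed beyond the neighbourhood-basis
  condition, and \<open>K\<close> and \<open>A\<close> depend only on the space.
\<close>

locale homogeneous_type =
  fixes d :: "'a::topological_space \<Rightarrow> 'a \<Rightarrow> real"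
    and M :: "'a measure"
  assumes borel: "sets M = sets borel"
    and nonneg: "0 \<le> d x y"
    and symmetric: "d x y = d y x"
    and positive: "0 < d x y \<longleftrightarrow> x \<noteq> y"
    and quasi_triangle: "\<exists>K. \<forall>x y z. d x y \<le> K * (d x z + d z y)"
    and ball_open: "0 < r \<Longrightarrow> open (qball d x r)"
    and ball_basis: "open U \<Longrightarrow> x \<in> U \<Longrightarrow> \<exists>r>0. qball d x r \<subseteq> U"
    and ball_positive: "0 < r \<Longrightarrow> 0 < emeasure M (qball d x r)"
    and ball_finite: "0 < r \<Longrightarrow> emeasure M (qball d x r) < \<infinity>"
    and doubling: "\<exists>A>0. \<forall>x. \<forall>r>0.
      emeasure M (qball d x (2 * r)) \<le> ennreal A * emeasure M (qball d x r)"

definition avg :: "'a measure \<Rightarrow> 'a set \<Rightarrow> ('a \<Rightarrow> 'b::{banach, second_countable_topology}) \<Rightarrow> 'b"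
  where "avg M B f = (1 / measure M B) *\<^sub>R (LINT y:B|M. f y)"

text \<open>Extended-valued, so that the supremum is meaningful without a finiteness assumption.\<close>

definition bmo_norm ::
    "('a \<Rightarrow> 'a \<Rightarrow> real) \<Rightarrow> 'a measure \<Rightarrow> ('a \<Rightarrow> 'b::{banach, second_countable_topology}) \<Rightarrow> ennreal"
  where "bmo_norm d M f =
    (SUP x. SUP r\<in>{0<..}.
      (\<integral>\<^sup>+y\<in>qball d x r. ennreal (norm (f y - avg M (qball d x r) f)) \<partial>M)
        / emeasure M (qball d x r))"

text \<open>
  Local integrability is integrability on every ball, which is what is needed for the averages
  over all balls to be defined.
\<close>

definition BMO ::
    "('a \<Rightarrow> 'a \<Rightarrow> real) \<Rightarrow> 'a measure \<Rightarrow> ('a \<Rightarrow> 'b::{banach, second_countable_topology}) set"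
  where "BMO d M =
    {f. (\<forall>x. \<forall>r>0. set_integrable M (qball d x r) f) \<and> bmo_norm d M f < \<infinity>}"

text \<open>Extended-valued: the supremum can be infinite at individual points.\<close>

definition restricted_maximal ::
    "('a \<Rightarrow> 'a \<Rightarrow> real) \<Rightarrow> 'a measure \<Rightarrow> ('a \<Rightarrow> 'b::real_normed_vector) \<Rightarrow> 'a \<Rightarrow> ennreal"
  where "restricted_maximal d M f x =
    (SUP r\<in>{0<..<1}.
      (\<integral>\<^sup>+y\<in>qball d x r. ennreal (norm (f y)) \<partial>M) / emeasure M (qball d x r))"

definition boundedly_supported :: "('a \<Rightarrow> 'a \<Rightarrow> real) \<Rightarrow> ('a \<Rightarrow> 'b::zero) \<Rightarrow> bool"
  where "boundedly_supported d g \<longleftrightarrow> (\<exists>x. \<exists>r>0. \<forall>y. y \<notin> qball d x r \<longrightarrow> g y = 0)"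

text \<open>
  The supremum over balls vanishes on constants. If the space is not a single ball, a nonzero
  constant \<open>c\<close> therefore cannot be approximated: a continuous, boundedly supported \<open>g\<close> with
  \<open>bmo_norm d M g \<le> a * bmo_norm d M (\<lambda>_. c) = 0\<close> is constant (all balls have positive measure),
  hence \<open>0\<close>. The following condition excludes exactly these functions.
\<close>

definition nondegenerate ::
    "('a \<Rightarrow> 'a \<Rightarrow> real) \<Rightarrow> 'a measure \<Rightarrow> ('a \<Rightarrow> 'b::zero) \<Rightarrow> bool"
  where "nondegenerate d M f \<longleftrightarrow>
    ((\<exists>c. c \<noteq> 0 \<and> (AE x in M. f x = c)) \<longrightarrow> (\<exists>x. \<exists>r>0. qball d x r = UNIV))"

end

theory Submission
  imports Defs
begin

text \<open>
  The approximations are \<open>S (\<eta> * T f)\<close>, where \<open>T\<close> truncates values at a height \<open>N\<close>, \<open>\<eta>\<close> is a cutoff that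
  equals 1 on a ball of radius \<open>N\<close>, and \<open>S\<close> replaces a function by averages at a small scale \<open>r\<close>, blended
  by a continuous partition of unity.

  Truncation is 1-Lipschitz, so it does not increase the mean oscillation. Multiplication by \<open>\<eta>\<close>
  adds at most \<open>N\<close> times the oscillation of \<open>\<eta>\<close>; this is harmless because there are cutoffs of
  arbitrarily small mean oscillation (\<open>ex_slow_cutoff\<close>): averages of indicators of balls around one
  point, with radii that grow fast enough for the measures of the balls to double. Such radii exist
  because an unbounded space of homogeneous type has infinite measure; in a bounded space the constant 1
  is a cutoff. The cutoffs are step functions, and it is the smoothing, which comes last, that restores
  continuity.

  The topology is normal, hence by Urysohn's lemma there is a continuous bump between a ball and its
  dilation by \<open>2 * K\<close>, where \<open>K\<close> is the constant of the quasi-triangle inequality, and bumps around a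
  maximal separated set give the partition of unity (\<open>ex_averaging_net\<close>). Doubling makes smoothing bounded, uniformly in the scale, for
  the mean oscillation (\<open>osc_bounded_smoothing\<close>) and in \<open>L\<^sup>1\<close> (\<open>smoothing_L1_le\<close>); for small scales the
  values are bounded by averages over centred balls of radius less than 1
  (\<open>smoothing_diff_const_le_ball\<close>), which gives the bound by the maximal function.

  Convergence almost everywhere is obtained from convergence in the mean. As the scale tends to 0,
  \<open>S g\<close> tends to \<open>g\<close> in \<open>L\<^sup>1\<close> (\<open>approximable_integrable\<close>): by uniform boundedness it suffices to look at
  indicators of open sets, where the error is concentrated near the boundary. For the \<open>j\<close>-th member of
  the sequence the scale is taken so small that the \<open>L\<^sup>1\<close> error is at most \<open>2\<close> to the power \<open>- j\<close>. The
  errors then tend to 0 almost everywhere, and \<open>\<eta> * T f\<close> agrees with \<open>f\<close> at any given point from some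
  \<open>j\<close> on.

  If the seminorm of \<open>f\<close> is 0, then \<open>f\<close> is almost everywhere a constant, and by nondegeneracy this
  constant is boundedly supported.
\<close>

section \<open>Balls, averages and oscillations\<close>

context homogeneous_type
begin

lemma space_UNIV [simp]: "space M = UNIV"
  using sets_eq_imp_space_eq[OF borel] by simp

lemma dist_self [simp]: "d x x = 0"
  using positive[of x x] nonneg[of x x] by simp

lemma mem_qball [simp]: "y \<in> qball d x r \<longleftrightarrow> d x y < r"
  by (simp add: qball_def)

lemma qball_sets [measurable, simp]: "qball d x r \<in> sets M"
proof (cases "0 < r")
  case True
  then show ?thesis by (simp add: borel ball_open)
next
  case False
  then have "qball d x r = {}" using nonneg[of x] by (auto simp: qball_def not_less intro: order_trans)
  then show ?thesis by simp
qed

lemma emeasure_qball: "0 < r \<Longrightarrow> emeasure M (qball d x r) = ennreal (measure M (qball d x r))"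
  using ball_finite[of r x] by (simp add: emeasure_eq_ennreal_measure)

lemma measure_qball_pos: "0 < r \<Longrightarrow> 0 < measure M (qball d x r)"
  using ball_positive[of r x] by (simp add: emeasure_qball)

text \<open>
  A ball of radius \<open>L * r\<close> around \<open>x\<close> lies in a ball around any point \<open>y\<close> at distance at most
  \<open>L * r\<close> from \<open>x\<close>, whose radius is a fixed multiple of \<open>r\<close>; doubling is then iterated.
\<close>

lemma doubling_comparable:
  "\<exists>C\<ge>1. \<forall>x y r. 0 < r \<longrightarrow> d x y \<le> L * r \<longrightarrow>
     emeasure M (qball d x (L * r)) \<le> ennreal C * emeasure M (qball d y r)"
proof -
  obtain K0 where K0: "\<And>x y z. d x y \<le> K0 * (d x z + d z y)" using quasi_triangle by blast
  define K where "K = max 1 K0"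
  have K1: "1 \<le> K" by (simp add: K_def)
  have K: "d x y \<le> K * (d x z + d z y)" for x y z
    using K0[of x y z] nonneg[of x z] nonneg[of z y] mult_right_mono[of K0 K "d x z + d z y"]
    by (simp add: K_def)
  obtain A where A: "0 < A" "\<And>x r. r > 0 \<Longrightarrow> 
      emeasure M (qball d x (2 * r)) \<le> ennreal A * emeasure M (qball d x r)"
    using doubling by blast
  define B where "B = max 1 A"
  have B1: "1 \<le> B" by (simp add: B_def)
  have B: "emeasure M (qball d x (2 * r)) \<le> ennreal B * emeasure M (qball d x r)" if "r > 0" for x r
    using A(2)[OF that, of x] by (rule order_trans) (auto simp: B_def intro!: mult_right_mono ennreal_leI)
  have iter: "emeasure M (qball d x (2^n * r)) \<le> ennreal (B^n) * emeasure M (qball d x r)"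
    if "r > 0" for x r n
  proof (induction n)
    case (Suc n)
    have "emeasure M (qball d x (2^Suc n * r)) \<le> ennreal B * emeasure M (qball d x (2^n * r))"
      using B[of "2^n*r" x] that by (simp add: mult.assoc)
    also have "\<dots> \<le> ennreal B * (ennreal (B^n) * emeasure M (qball d x r))"
      by (intro mult_left_mono Suc.IH) auto
    also have "\<dots> = ennreal (B^Suc n) * emeasure M (qball d x r)"
      using B1 by (simp add: ennreal_mult' mult.assoc)
    finally show ?case .
  qed simp
  obtain n where n: "2 * K * L < 2^n" using real_arch_pow[of 2 "2*K*L"] by auto
  show ?thesis
  proof (intro exI[of _ "B^n"] conjI allI impI)
    show "1 \<le> B^n" using B1 by simp
    fix x y r assume r: "0 < r" and xy: "d x y \<le> L * r"
    have "qball d x (L * r) \<subseteq> qball d y (2^n * r)"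
    proof
      fix z assume "z \<in> qball d x (L * r)"
      then have z: "d x z < L * r" by simp
      have "d y z \<le> K * (d y x + d x z)" by (rule K)
      also have "\<dots> \<le> K * (L * r + L * r)" using z xy K1 symmetric[of x y]
        by (intro mult_left_mono) auto
      also have "\<dots> = (2 * K * L) * r" by (simp add: algebra_simps)
      also have "\<dots> < 2^n * r" using n r by (intro mult_strict_right_mono) auto
      finally show "z \<in> qball d y (2^n * r)" by simp
    qed
    then have "emeasure M (qball d x (L * r)) \<le> emeasure M (qball d y (2^n * r))"
      by (intro emeasure_mono) auto
    also have "\<dots> \<le> ennreal (B^n) * emeasure M (qball d y r)" by (rule iter[OF r])
    finally show "emeasure M (qball d x (L * r)) \<le> ennreal (B^n) * emeasure M (qball d y r)" .
  qed
qed

lemma avg_diff_const_le: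
  fixes g :: "'a \<Rightarrow> 'b::{banach, second_countable_topology}"
  assumes g: "set_integrable M (qball d x r) g" and r: "0 < r"
  shows "ennreal (norm (avg M (qball d x r) g - c)) * emeasure M (qball d x r)
     \<le> (\<integral>\<^sup>+y\<in>qball d x r. ennreal (norm (g y - c)) \<partial>M)"
proof -
  let ?B = "qball d x r"
  have fin: "emeasure M ?B < \<infinity>" and pos: "0 < emeasure M ?B"
    using ball_finite[OF r] ball_positive[OF r] by auto
  have m: "emeasure M ?B = ennreal (measure M ?B)" using fin by (simp add: emeasure_eq_ennreal_measure)
  have m0: "measure M ?B > 0" using pos m by (metis ennreal_less_zero_iff)
  have gc: "set_integrable M ?B (\<lambda>y. c)" using fin by (simp add: set_integrable_def)
  have "measure M ?B *\<^sub>R (avg M ?B g - c) = (LINT y:?B|M. g y) - (LINT y:?B|M. c)"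
    using m0 fin by (simp add: avg_def scaleR_diff_right set_lebesgue_integral_def)
  also have "\<dots> = (LINT y:?B|M. g y - c)" using set_integral_diff[OF g gc] by simp
  finally have eq: "measure M ?B *\<^sub>R (avg M ?B g - c) = (LINT y:?B|M. g y - c)" .
  have "ennreal (norm (avg M ?B g - c)) * emeasure M ?B = ennreal (norm (measure M ?B *\<^sub>R (avg M ?B g - c)))"
    using m0 by (simp add: m ennreal_mult'' mult.commute)
  also have "\<dots> \<le> (\<integral>\<^sup>+y. ennreal (norm (indicator ?B y *\<^sub>R (g y - c))) \<partial>M)"
    unfolding eq set_lebesgue_integral_def
    by (rule integral_norm_bound_ennreal) (use set_integral_diff(1)[OF g gc] in \<open>simp add: set_integrable_def\<close>)
  also have "\<dots> = (\<integral>\<^sup>+y\<in>?B. ennreal (norm (g y - c)) \<partial>M)"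
    by (intro nn_integral_cong) (auto simp: indicator_def)
  finally show ?thesis .
qed

end

text \<open>
  The deviation from the best constant on each ball instead of the deviation from the average. The
  two differ by a factor of at most 2, and in estimates a constant can be chosen to fit, for example
  one that comes from a larger ball.
\<close>

definition osc_bounded ::
    "('a \<Rightarrow> 'a \<Rightarrow> real) \<Rightarrow> 'a measure \<Rightarrow> ('a \<Rightarrow> 'b::real_normed_vector) \<Rightarrow> ennreal \<Rightarrow> bool"
  where "osc_bounded d M g b \<longleftrightarrow> (\<forall>x. \<forall>r>0. \<exists>c.
    (\<integral>\<^sup>+y\<in>qball d x r. ennreal (norm (g y - c)) \<partial>M) \<le> b * emeasure M (qball d x r))"

lemma osc_boundedE:
  assumes "osc_bounded d M g b" "0 < r"
  obtains c where "(\<integral>\<^sup>+y\<in>qball d x r. ennreal (norm (g y - c)) \<partial>M) \<le> b * emeasure M (qball d x r)"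
  using assms unfolding osc_bounded_def by blast

context homogeneous_type
begin

lemma osc_bounded_bmo_norm:
  fixes f :: "'a \<Rightarrow> 'b::{banach, second_countable_topology}"
  shows "osc_bounded d M f (bmo_norm d M f)"
  unfolding osc_bounded_def
proof (intro allI impI)
  fix x and r :: real assume r: "r > 0"
  let ?B = "qball d x r" let ?I = "\<integral>\<^sup>+y\<in>?B. ennreal (norm (f y - avg M ?B f)) \<partial>M"
  have fin: "emeasure M ?B < \<infinity>" and pos: "0 < emeasure M ?B"
    using ball_finite[OF r] ball_positive[OF r] by auto
  have "?I / emeasure M ?B \<le> bmo_norm d M f"
    unfolding bmo_norm_def using r by (intro SUP_upper2[of x] SUP_upper2[of r]) auto
  then have "?I / emeasure M ?B * emeasure M ?B \<le> bmo_norm d M f * emeasure M ?B"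
    by (rule mult_right_mono) auto
  then have "?I \<le> bmo_norm d M f * emeasure M ?B"
    using fin pos by (simp add: ennreal_divide_times less_top[symmetric] ennreal_mult_divide_eq)
  then show "\<exists>c. (\<integral>\<^sup>+y\<in>?B. ennreal (norm (f y - c)) \<partial>M) \<le> bmo_norm d M f * emeasure M ?B" by blast
qed

lemma bmo_norm_le:
  fixes g :: "'a \<Rightarrow> 'b::{banach, second_countable_topology}"
  assumes g: "integrable M g" and osc: "osc_bounded d M g b"
  shows "bmo_norm d M g \<le> 2 * b"
  unfolding bmo_norm_def
proof (intro SUP_least)
  fix x and r :: real assume "r \<in> {0<..}"
  then have r: "r > 0" by simp
  let ?B = "qball d x r"
  have gm [measurable]: "g \<in> borel_measurable M" using g by auto
  have fin: "emeasure M ?B < \<infinity>" and pos: "0 < emeasure M ?B"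
    using ball_finite[OF r] ball_positive[OF r] by auto
  have gB: "set_integrable M ?B g" using g by (simp add: set_integrable_def integrable_mult_indicator)
  obtain c where c: "(\<integral>\<^sup>+y\<in>?B. ennreal (norm (g y - c)) \<partial>M) \<le> b * emeasure M ?B"
    using osc_boundedE[OF osc r] by blast
  let ?m = "avg M ?B g"
  have "(\<integral>\<^sup>+y\<in>?B. ennreal (norm (g y - ?m)) \<partial>M)
     \<le> (\<integral>\<^sup>+y. ennreal (norm (g y - c)) * indicator ?B y + ennreal (norm (?m - c)) * indicator ?B y \<partial>M)"
  proof (rule nn_integral_mono)
    fix y
    have "norm (g y - ?m) \<le> norm (g y - c) + norm (?m - c)"
      using norm_triangle_ineq4[of "g y - c" "?m - c"] by simp
    then show "ennreal (norm (g y - ?m)) * indicator ?B y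
        \<le> ennreal (norm (g y - c)) * indicator ?B y + ennreal (norm (?m - c)) * indicator ?B y"
      by (auto simp: indicator_def ennreal_plus[symmetric] simp del: ennreal_plus intro!: ennreal_leI)
  qed
  also have "\<dots> = (\<integral>\<^sup>+y\<in>?B. ennreal (norm (g y - c)) \<partial>M) + ennreal (norm (?m - c)) * emeasure M ?B"
    by (subst nn_integral_add) (auto simp: nn_integral_cmult_indicator)
  also have "\<dots> \<le> b * emeasure M ?B + b * emeasure M ?B"
    by (intro add_mono c order_trans[OF avg_diff_const_le[OF gB r] c])
  also have "\<dots> = 2 * b * emeasure M ?B" by (metis distrib_right mult_2)
  finally show "(\<integral>\<^sup>+y\<in>?B. ennreal (norm (g y - ?m)) \<partial>M) / emeasure M ?B \<le> 2 * b"
    using pos fin by (intro divide_le_posI_ennreal) (auto simp: mult.commute)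
qed

end

section \<open>Normality and partitions of unity\<close>

text \<open>
  Two constants fixed once for the whole construction. The factor \<open>8 * K^4\<close> is chosen because a
  smoothing at scale \<open>r\<close> averages over balls of radius \<open>r / (2 * K)\<close>, and \<open>8 * K^4\<close> times this radius
  is \<open>4 * K^3 * r\<close>: a ball that large contains every averaging ball relevant near its centre.
\<close>

locale homogeneous_constants = homogeneous_type d M
  for d :: "'a::topological_space \<Rightarrow> 'a \<Rightarrow> real" and M :: "'a measure" +
  fixes K C :: real
  assumes K_ge_1: "1 \<le> K"
    and triangle: "d x y \<le> K * (d x z + d z y)"
    and C_ge_1: "1 \<le> C"
    and comparable: "0 < r \<Longrightarrow> d x y \<le> 8 * K^4 * r \<Longrightarrow>
      emeasure M (qball d x (8 * K^4 * r)) \<le> ennreal C * emeasure M (qball d y r)"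

lemma (in homogeneous_type) ex_constants: "\<exists>K C. homogeneous_constants d M K C"
proof -
  obtain K0 where K0: "\<And>x y z. d x y \<le> K0 * (d x z + d z y)" using quasi_triangle by blast
  define K where "K = max 1 K0"
  have K: "d x y \<le> K * (d x z + d z y)" for x y z
    using K0[of x y z] nonneg[of x z] nonneg[of z y] mult_right_mono[of K0 K "d x z + d z y"]
    by (simp add: K_def)
  obtain C where "C \<ge> 1" "\<And>x y r. 0 < r \<Longrightarrow> d x y \<le> 8 * K^4 * r \<Longrightarrow>
     emeasure M (qball d x (8 * K^4 * r)) \<le> ennreal C * emeasure M (qball d y r)"
    using doubling_comparable[of "8 * K^4"] by blast
  then have "homogeneous_constants d M K C"
    by unfold_locales (use K in \<open>auto simp: K_def\<close>)
  then show ?thesis by blast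
qed

context homogeneous_constants
begin

text \<open>
  Two disjoint closed sets are separated by unions of balls whose radii are shrunk by \<open>2 * K\<close>: if two
  such balls met, then the larger of the original two would contain the centre of the other one.
\<close>

lemma normal: "normal_space (euclidean :: 'a topology)"
  unfolding normal_space_def
proof (intro allI impI)
  fix S T :: "'a set"
  assume "closedin euclidean S \<and> closedin euclidean T \<and> disjnt S T"
  then have S: "open (- S)" and T: "open (- T)" and ST: "S \<inter> T = {}"
    by (auto simp: disjnt_def closed_def)
  have "\<forall>x\<in>S. \<exists>r>0. qball d x r \<subseteq> - T" using ball_basis[OF T] ST by blast
  then obtain p where p: "\<And>x. x \<in> S \<Longrightarrow> 0 < p x" "\<And>x. x \<in> S \<Longrightarrow> qball d x (p x) \<subseteq> - T" by metis
  have "\<forall>x\<in>T. \<exists>r>0. qball d x r \<subseteq> - S" using ball_basis[OF S] ST by blast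
  then obtain q where q: "\<And>x. x \<in> T \<Longrightarrow> 0 < q x" "\<And>x. x \<in> T \<Longrightarrow> qball d x (q x) \<subseteq> - S" by metis
  define U where "U = (\<Union>x\<in>S. qball d x (p x / (2 * K)))"
  define V where "V = (\<Union>x\<in>T. qball d x (q x / (2 * K)))"
  have "openin euclidean U" "openin euclidean V"
    unfolding U_def V_def using p q K_ge_1 by (auto intro!: ball_open open_UN)
  moreover have "S \<subseteq> U" "T \<subseteq> V"
    unfolding U_def V_def using p(1) q(1) K_ge_1 by (auto intro!: bexI)
  moreover have "disjnt U V"
  proof (rule ccontr)
    assume "\<not> disjnt U V"
    then obtain z x y where x: "x \<in> S" "d x z < p x / (2 * K)" and y: "y \<in> T" "d y z < q y / (2 * K)"
      by (auto simp: disjnt_def U_def V_def)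
    have "d x y \<le> K * (d x z + d z y)" by (rule triangle)
    also have "\<dots> < K * (p x / (2 * K) + q y / (2 * K))"
      using x y K_ge_1 symmetric[of z y] by (intro mult_strict_left_mono) auto
    also have "\<dots> = (p x + q y) / 2" using K_ge_1 by (simp add: field_simps)
    finally have "d x y < p x \<or> d y x < q y" unfolding symmetric[of y x] by (cases "p x \<le> q y") auto
    then show False using p(2)[OF x(1)] q(2)[OF y(1)] x y by auto
  qed
  ultimately show "\<exists>U V. openin euclidean U \<and> openin euclidean V \<and> S \<subseteq> U \<and> T \<subseteq> V \<and> disjnt U V"
    by blast
qed

text \<open>
  The closure of a ball of radius \<open>r\<close> lies in the ball of radius \<open>2 * K * r\<close>, so Urysohn's lemma
  applies. The quasi-metric itself may be discontinuous, hence a function of \<open>d x y\<close> cannot serve.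
\<close>

lemma ex_bump:
  assumes r: "0 < r"
  shows "\<exists>\<phi>. continuous_on UNIV \<phi> \<and> (\<forall>y. 0 \<le> \<phi> y) \<and>
    (\<forall>y. d x y < r \<longrightarrow> \<phi> y = (1::real)) \<and> (\<forall>y. 2 * K * r \<le> d x y \<longrightarrow> \<phi> y = 0)"
proof -
  define S where "S = closure (qball d x r)"
  define T where "T = - qball d x (2 * K * r)"
  have "closedin euclidean S" "closedin euclidean T"
    unfolding S_def T_def using ball_open[of "2*K*r" x] r K_ge_1 by (auto simp: closed_def)
  moreover have "disjnt T S"
  proof -
    have False if "z \<in> S" "z \<in> T" for z
    proof -
      have "qball d z r \<inter> qball d x r \<noteq> {}"
        using that(1) open_Int_closure_eq_empty[OF ball_open[OF r], of z "qball d x r"] r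
          mem_qball[of z z r] unfolding S_def dist_self by blast
      then obtain y where y: "d z y < r" "d x y < r" by auto
      have "d x z \<le> K * (d x y + d y z)" by (rule triangle)
      also have "\<dots> < K * (r + r)" using y K_ge_1 symmetric[of y z] by (intro mult_strict_left_mono) auto
      finally show False using that(2) by (simp add: T_def)
    qed
    then show ?thesis by (auto simp: disjnt_def)
  qed
  ultimately obtain f where f: "continuous_map euclidean (top_of_set {0..1::real}) f" "f ` T \<subseteq> {0}" "f ` S \<subseteq> {1}"
    using Urysohn_lemma[OF normal, of T S 0 1] by (metis zero_le_one)
  have "continuous_on UNIV f" "\<And>y. 0 \<le> f y"
    using f(1) by (auto simp: continuous_map_in_subtopology image_subset_iff)
  moreover have "f y = 1" if "d x y < r" for y
  proof -
    have "y \<in> S" using that closure_subset[of "qball d x r"] unfolding S_def by auto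
    then show ?thesis using f(3) by auto
  qed
  moreover have "f y = 0" if "2 * K * r \<le> d x y" for y
    using f(2) that by (auto simp: T_def image_subset_iff)
  ultimately show ?thesis by blast
qed

text \<open>
  A partition of unity at scale \<open>r\<close> over the region \<open>Q\<close>, indexed by finitely many centres. The weights
  live on balls of radius \<open>2 * K * r\<close>, which may overlap; the balls of radius \<open>r / (2 * K)\<close>, over which
  functions are averaged, are disjoint. The disjointness makes sums over \<open>E\<close> of integrals over the
  averaging balls trivial to bound, so that the overlap of the larger balls never has to be counted.
\<close>

definition averaging_net where
  "averaging_net Q r E w \<longleftrightarrow> finite E \<and>
    (\<forall>i\<in>E. \<forall>k\<in>E. i \<noteq> k \<longrightarrow> qball d i (r / (2 * K)) \<inter> qball d k (r / (2 * K)) = {}) \<and>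
    (\<forall>i\<in>E. continuous_on UNIV (w i)) \<and> (\<forall>i y. 0 \<le> (w i y :: real)) \<and>
    (\<forall>i y. 2 * K * r \<le> d i y \<longrightarrow> w i y = 0) \<and>
    (\<forall>y. (\<Sum>i\<in>E. w i y) \<le> 1) \<and> (\<forall>y\<in>Q. (\<Sum>i\<in>E. w i y) = 1)"

lemma qball_subset:
  assumes "d x y \<le> s" "K * (s + t) \<le> u"
  shows "qball d y t \<subseteq> qball d x u"
proof
  fix z assume "z \<in> qball d y t"
  then have z: "d y z < t" by simp
  have "d x z \<le> K * (d x y + d y z)" by (rule triangle)
  also have "\<dots> < K * (s + t)" using z assms(1) K_ge_1 by (intro mult_strict_left_mono) auto
  finally show "z \<in> qball d x u" using assms(2) by simp
qed

lemma separated_balls_disjoint: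
  assumes "r \<le> d i k"
  shows "qball d i (r / (2 * K)) \<inter> qball d k (r / (2 * K)) = {}"
proof (rule ccontr)
  assume "\<not> ?thesis"
  then obtain z where z: "d i z < r / (2 * K)" "d k z < r / (2 * K)" by auto
  have "d i k \<le> K * (d i z + d z k)" by (rule triangle)
  also have "\<dots> < K * (r / (2 * K) + r / (2 * K))"
    using z K_ge_1 symmetric[of z k] by (intro mult_strict_left_mono) auto
  also have "\<dots> = r" using K_ge_1 by (simp add: field_simps)
  finally show False using assms by simp
qed

text \<open>
  The balls of radius \<open>r / (2 * K)\<close> around the points are disjoint, lie in one large ball, and each
  carries a fixed fraction of its measure.
\<close>

lemma separated_card_le:
  assumes r: "0 < r" and R: "0 < R"
  shows "\<exists>N. \<forall>E. finite E \<longrightarrow> E \<subseteq> qball d x R \<longrightarrow>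
    (\<forall>i\<in>E. \<forall>k\<in>E. i \<noteq> k \<longrightarrow> r \<le> d i k) \<longrightarrow> card E \<le> N"
proof -
  define \<rho> where "\<rho> = r / (2 * K)"
  have \<rho>: "\<rho> > 0" using r K_ge_1 by (simp add: \<rho>_def)
  define L where "L = K * (R + \<rho>) / \<rho>"
  have L: "L * \<rho> = K * (R + \<rho>)" using \<rho> by (simp add: L_def)
  obtain D where D: "D \<ge> 1" "\<And>x y r. 0 < r \<Longrightarrow> d x y \<le> L * r \<Longrightarrow>
     emeasure M (qball d x (L * r)) \<le> ennreal D * emeasure M (qball d y r)"
    using doubling_comparable[of L] by blast
  let ?Q = "qball d x (L * \<rho>)"
  have "L * \<rho> > 0" unfolding L using R \<rho> K_ge_1 by simp
  then have Q: "emeasure M ?Q = ennreal (measure M ?Q)" "0 < measure M ?Q"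
    by (rule emeasure_qball, rule measure_qball_pos)
  obtain N :: nat where N: "D \<le> real N" using real_arch_simple by blast
  show ?thesis
  proof (intro exI[of _ N] allI impI)
    fix E assume E: "finite E" "E \<subseteq> qball d x R" and sep: "\<forall>i\<in>E. \<forall>k\<in>E. i \<noteq> k \<longrightarrow> r \<le> d i k"
    have sub: "qball d i \<rho> \<subseteq> ?Q" if "i \<in> E" for i
      using that E(2) L by (intro qball_subset[of _ _ R]) auto
    have *: "emeasure M ?Q \<le> ennreal D * emeasure M (qball d i \<rho>)" if "i \<in> E" for i
    proof (rule D(2)[OF \<rho>])
      have "d x i < R" using that E(2) by auto
      also have "R \<le> K * (R + \<rho>)" using K_ge_1 R \<rho> mult_mono[of 1 K R "R + \<rho>"] by simp
      finally show "d x i \<le> L * \<rho>" using L by simp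
    qed
    have disj: "disjoint_family_on (\<lambda>i. qball d i \<rho>) E"
      unfolding disjoint_family_on_def \<rho>_def using separated_balls_disjoint sep by blast
    have "of_nat (card E) * emeasure M ?Q = (\<Sum>i\<in>E. emeasure M ?Q)" by simp
    also have "\<dots> \<le> (\<Sum>i\<in>E. ennreal D * emeasure M (qball d i \<rho>))" by (intro sum_mono *)
    also have "\<dots> = ennreal D * (\<Sum>i\<in>E. emeasure M (qball d i \<rho>))"
      by (rule sum_distrib_left[symmetric])
    also have "(\<Sum>i\<in>E. emeasure M (qball d i \<rho>)) = emeasure M (\<Union>i\<in>E. qball d i \<rho>)"
      using disj E(1) by (intro sum_emeasure) auto
    also have "ennreal D * emeasure M (\<Union>i\<in>E. qball d i \<rho>) \<le> ennreal D * emeasure M ?Q"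
      using sub by (intro mult_left_mono emeasure_mono) auto
    finally have "ennreal (real (card E)) * emeasure M ?Q \<le> ennreal D * emeasure M ?Q"
      by (simp add: ennreal_of_nat_eq_real_of_nat)
    then have "real (card E) * measure M ?Q \<le> D * measure M ?Q"
      using D(1) unfolding Q(1) by (simp add: ennreal_mult'[symmetric])
    then have "real (card E) \<le> D" using Q(2) by simp
    then show "card E \<le> N" using N by simp
  qed
qed

text \<open>
  A separated set of maximal cardinality in the ball is automatically an \<open>r\<close>-net of it, and the
  normalised bumps around its points are the weights.
\<close>

lemma ex_averaging_net:
  assumes r: "0 < r" and R: "0 < R"
  shows "\<exists>E w. averaging_net (qball d x R) r E w"
proof -
  define sep where "sep E \<longleftrightarrow> finite E \<and> E \<subseteq> qball d x R \<and> (\<forall>i\<in>E. \<forall>k\<in>E. i \<noteq> k \<longrightarrow> r \<le> d i k)" for E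
  obtain N where N': "\<forall>E. finite E \<longrightarrow> E \<subseteq> qball d x R \<longrightarrow>
      (\<forall>i\<in>E. \<forall>k\<in>E. i \<noteq> k \<longrightarrow> r \<le> d i k) \<longrightarrow> card E \<le> N"
    using separated_card_le[OF r R, of x] by (rule exE)
  have N: "card E \<le> N" if "sep E" for E
    using N'[rule_format, of E] that by (simp add: sep_def)
  have "sep {}" by (simp add: sep_def)
  then obtain E where E: "sep E" "\<And>F. sep F \<Longrightarrow> card F \<le> card E"
    using ex_has_greatest_nat[of sep "{}" card "Suc N"] N by (auto simp: less_Suc_eq_le)
  have fin: "finite E" using E by (simp add: sep_def)
  have cover: "\<exists>i\<in>E. d i y < r" if y: "d x y < R" for y
  proof (rule ccontr)
    assume no: "\<not> ?thesis"
    then have "y \<notin> E" using r by force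
    moreover have "sep (insert y E)" using E(1) no y symmetric unfolding sep_def
      by (auto simp: not_less)
    ultimately show False using E(2)[of "insert y E"] fin by simp
  qed
  obtain \<phi> where \<phi>: "\<And>i. continuous_on UNIV (\<phi> i)" "\<And>i y. 0 \<le> \<phi> i y"
    "\<And>i y. d i y < r \<Longrightarrow> \<phi> i y = (1::real)" "\<And>i y. 2 * K * r \<le> d i y \<Longrightarrow> \<phi> i y = 0"
    using ex_bump[OF r] by metis
  \<comment> \<open>The sum of the bumps may vanish far away, where it cannot be a denominator. It is at least 1 on the
    ball, so the maximum with 1 changes nothing there and keeps the quotients continuous everywhere.\<close>
  define \<Phi> where "\<Phi> y = max 1 (\<Sum>i\<in>E. \<phi> i y)" for y
  have \<Phi>: "\<Phi> y \<ge> 1" "(\<Sum>i\<in>E. \<phi> i y) \<le> \<Phi> y" for y by (auto simp: \<Phi>_def)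
  have \<Phi>Q: "\<Phi> y = (\<Sum>i\<in>E. \<phi> i y)" if y: "d x y < R" for y
  proof -
    obtain i where i: "i \<in> E" "d i y < r" using cover[OF y] by blast
    have "1 = \<phi> i y" using \<phi>(3) i by simp
    also have "\<dots> \<le> (\<Sum>i\<in>E. \<phi> i y)" using fin i \<phi>(2) by (intro member_le_sum) auto
    finally show ?thesis by (simp add: \<Phi>_def)
  qed
  define w where "w i y = \<phi> i y / \<Phi> y" for i y
  have ws: "(\<Sum>i\<in>E. w i y) = (\<Sum>i\<in>E. \<phi> i y) / \<Phi> y" for y by (simp add: w_def sum_divide_distrib)
  have \<Phi>pos: "0 < \<Phi> y" "\<Phi> y \<noteq> 0" for y using \<Phi>(1)[of y] by linarith+
  have cont: "continuous_on UNIV \<Phi>" unfolding \<Phi>_def by (intro continuous_intros \<phi>)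
  have "averaging_net (qball d x R) r E w"
    unfolding averaging_net_def
  proof (intro conjI ballI allI impI)
    show "finite E" by fact
    show "qball d i (r / (2 * K)) \<inter> qball d k (r / (2 * K)) = {}" if "i \<in> E" "k \<in> E" "i \<noteq> k" for i k
      using that E(1) by (intro separated_balls_disjoint) (auto simp: sep_def)
    show "continuous_on UNIV (w i)" for i
      unfolding w_def using \<Phi>pos by (intro continuous_intros \<phi> cont) auto
    show "0 \<le> w i y" for i y using \<phi>(2) \<Phi>pos[of y] by (simp add: w_def)
    show "w i y = 0" if "2 * K * r \<le> d i y" for i y using \<phi>(4)[OF that] by (simp add: w_def)
    show "(\<Sum>i\<in>E. w i y) \<le> 1" for y using \<Phi>[of y] \<Phi>pos[of y] by (simp add: ws)
    show "(\<Sum>i\<in>E. w i y) = 1" if "y \<in> qball d x R" for y using \<Phi>Q[of y] that \<Phi>pos[of y] by (simp add: ws)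
  qed
  then show ?thesis by blast
qed


section \<open>Smoothing and its bounds\<close>

lemma averaging_netD:
  assumes "averaging_net Q r E w"
  shows "finite E" "disjoint_family_on (\<lambda>i. qball d i (r / (2 * K))) E"
    "\<And>i. i \<in> E \<Longrightarrow> continuous_on UNIV (w i)" "\<And>i y. 0 \<le> w i y"
    "\<And>i y. w i y \<noteq> 0 \<Longrightarrow> d i y < 2 * K * r"
    "\<And>y. (\<Sum>i\<in>E. w i y) \<le> 1" "\<And>y. y \<in> Q \<Longrightarrow> (\<Sum>i\<in>E. w i y) = 1"
  using assms unfolding averaging_net_def disjoint_family_on_def by (auto simp: not_less[symmetric])

text \<open>
  The averages are taken over the small disjoint balls of the net and not over the larger balls that
  carry the weights; by doubling the two choices lead to comparable bounds.
\<close>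

definition smoothing where
  "smoothing r E w g y = (\<Sum>i\<in>E. w i y *\<^sub>R avg M (qball d i (r / (2 * K))) g)"

lemma continuous_borel_measurable:
  "continuous_on UNIV h \<Longrightarrow> h \<in> borel_measurable M"
  using borel_measurable_continuous_onI measurable_cong_sets[OF borel refl] by blast

lemma continuous_smoothing:
  "averaging_net Q r E w \<Longrightarrow> continuous_on UNIV (smoothing r E w g)"
  unfolding smoothing_def by (intro continuous_intros averaging_netD(3))

lemma measurable_smoothing:
  "averaging_net Q r E w \<Longrightarrow> smoothing r E w g \<in> borel_measurable M"
  by (rule continuous_borel_measurable[OF continuous_smoothing])

lemma integrable_imp_set_integrable:
  fixes g :: "'a \<Rightarrow> 'b::{banach, second_countable_topology}"
  shows "integrable M g \<Longrightarrow> set_integrable M (qball d x r) g"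
  by (simp add: set_integrable_def integrable_mult_indicator)

lemma smoothing_add:
  fixes g h :: "'a \<Rightarrow> 'b::{banach, second_countable_topology}"
  assumes "integrable M g" "integrable M h"
  shows "smoothing r E w (\<lambda>x. g x + h x) y = smoothing r E w g y + smoothing r E w h y"
  unfolding smoothing_def avg_def
  by (simp add: assms set_integral_add integrable_imp_set_integrable sum.distrib scaleR_add_right)

lemma smoothing_diff:
  fixes g h :: "'a \<Rightarrow> 'b::{banach, second_countable_topology}"
  assumes "integrable M g" "integrable M h"
  shows "smoothing r E w (\<lambda>x. g x - h x) y = smoothing r E w g y - smoothing r E w h y"
  unfolding smoothing_def avg_def
  by (simp add: assms set_integral_diff integrable_imp_set_integrable sum_subtractf scaleR_diff_right)

lemma bounded_smoothing:
  fixes g :: "'a \<Rightarrow> 'b::{banach, second_countable_topology}"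
  assumes net: "averaging_net Q r E w"
  shows "bounded (range (smoothing r E w g))"
proof (intro boundedI)
  fix v assume "v \<in> range (smoothing r E w g)"
  then obtain y where v: "v = smoothing r E w g y" by blast
  have "w i y \<le> 1" if "i \<in> E" for i
    using member_le_sum[of i E "\<lambda>i. w i y"] that averaging_netD(1,4)[OF net] averaging_netD(6)[OF net, of y]
    by force
  then have "norm (w i y *\<^sub>R u) \<le> norm u" if "i \<in> E" for i and u :: 'b
    using averaging_netD(4)[OF net, of i y] that by (simp add: mult_left_le_one_le)
  then show "norm v \<le> (\<Sum>i\<in>E. norm (avg M (qball d i (r / (2 * K))) g))"
    unfolding v smoothing_def by (intro sum_norm_le) auto
qed

lemma qball_mono: "r \<le> s \<Longrightarrow> qball d x r \<subseteq> qball d x s"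
  by (auto simp: qball_def)

text \<open>
  The parameter \<open>s\<close> is the radius of the ball on which an oscillation is estimated; it is at least the
  scale \<open>r\<close> of the smoothing. All averaging balls with influence on that ball lie in its dilation by
  \<open>4 * K^3\<close>.
\<close>

lemma small_ball_subset:
  assumes r: "0 < r" "r \<le> s" and xy: "d x y < s" and iy: "d i y < 2 * K * r"
  shows "d x i \<le> 4 * K^3 * s" "qball d i (r / (2 * K)) \<subseteq> qball d x (4 * K^3 * s)"
proof -
  have s: "0 < s" using r by simp
  have K2: "K \<le> K^2" "K^2 \<le> K^3" "1 \<le> K^3"
    using K_ge_1 power_increasing[of 1 2 K] power_increasing[of 2 3 K] by (auto simp: one_le_power)
  have *: "d x i \<le> 3 * K^2 * s"
  proof -
    have "2 * K * r \<le> 2 * K * s" using r K_ge_1 by (intro mult_left_mono) auto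
    then have yi: "d y i \<le> 2 * K * s" using iy symmetric[of i y] by simp
    have "d x i \<le> K * (d x y + d y i)" by (rule triangle)
    also have "\<dots> \<le> K * (s + 2 * K * s)"
      using xy yi K_ge_1 by (intro mult_left_mono add_mono) auto
    also have "\<dots> = K * s + 2 * K^2 * s" by (simp add: algebra_simps power2_eq_square)
    also have "\<dots> \<le> K^2 * s + 2 * K^2 * s" using K2(1) s by simp
    also have "\<dots> = 3 * K^2 * s" by (simp add: algebra_simps)
    finally show ?thesis .
  qed
  then show "d x i \<le> 4 * K^3 * s"
    using mult_right_mono[of "3 * K^2" "4 * K^3" s] s K2 by linarith
  show "qball d i (r / (2 * K)) \<subseteq> qball d x (4 * K^3 * s)"
  proof (rule qball_subset[OF *])
    have "K * (3 * K^2 * s + r / (2 * K)) = 3 * K^3 * s + r / 2"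
      using K_ge_1 by (simp add: algebra_simps power2_eq_square power3_eq_cube)
    also have "\<dots> \<le> 3 * K^3 * s + K^3 * s"
      using r mult_right_mono[OF K2(3), of s] by linarith
    finally show "K * (3 * K^2 * s + r / (2 * K)) \<le> 4 * K^3 * s" by (simp add: algebra_simps)
  qed
qed

lemma scale_small: "8 * K^4 * (r / (2 * K)) = 4 * K^3 * r"
  using K_ge_1 by (simp add: field_simps power3_eq_cube power4_eq_xxxx)

lemma comparable_small_ball:
  assumes r: "0 < r" and "d x y < r" "d i y < 2 * K * r"
  shows "emeasure M (qball d x (4 * K^3 * r)) \<le> ennreal C * emeasure M (qball d i (r / (2 * K)))"
  using comparable[of "r / (2 * K)" x i, unfolded scale_small]
    small_ball_subset(1)[OF r order_refl assms(2,3)] r K_ge_1 by simp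

lemma comparable_support:
  assumes r: "0 < r"
  shows "emeasure M (qball d i (2 * K * r)) \<le> ennreal C * emeasure M (qball d i (r / (2 * K)))"
proof -
  have "2 * K \<le> 4 * K^3"
    using K_ge_1 power_increasing[of 1 3 K] by simp
  then have "2 * K * r \<le> 4 * K^3 * r" using r by (intro mult_right_mono) auto
  then have "emeasure M (qball d i (2 * K * r)) \<le> emeasure M (qball d i (4 * K^3 * r))"
    by (intro emeasure_mono qball_mono) auto
  also have "\<dots> \<le> ennreal C * emeasure M (qball d i (r / (2 * K)))"
    using comparable[of "r / (2 * K)" i i, unfolded scale_small] r K_ge_1 by simp
  finally show ?thesis .
qed

lemma comparable_dilate:
  assumes s: "0 < s"
  shows "emeasure M (qball d x (4 * K^3 * s)) \<le> ennreal C * emeasure M (qball d x s)"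
proof -
  have "K^3 \<le> K^4" "0 \<le> K^4" using K_ge_1 by (auto intro: power_increasing)
  then have "4 * K^3 \<le> 8 * K^4" by linarith
  then have "4 * K^3 * s \<le> 8 * K^4 * s" using s by (intro mult_right_mono) auto
  then have "emeasure M (qball d x (4 * K^3 * s)) \<le> emeasure M (qball d x (8 * K^4 * s))"
    by (intro emeasure_mono qball_mono) auto
  also have "\<dots> \<le> ennreal C * emeasure M (qball d x s)"
    using comparable[of s x x] s K_ge_1 by simp
  finally show ?thesis .
qed

definition mean_dev where
  "mean_dev B g c = ennreal (1 / measure M B) * (\<integral>\<^sup>+z\<in>B. ennreal (norm (g z - c)) \<partial>M)"

lemma avg_le_mean_dev:
  fixes g :: "'a \<Rightarrow> 'b::{banach, second_countable_topology}"
  assumes "set_integrable M (qball d x r) g" "0 < r"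
  shows "ennreal (norm (avg M (qball d x r) g - c)) \<le> mean_dev (qball d x r) g c"
proof -
  let ?m = "measure M (qball d x r)" let ?a = "norm (avg M (qball d x r) g - c)"
  have m: "?m > 0" by (rule measure_qball_pos[OF assms(2)])
  have "ennreal ?a = ennreal (1 / ?m) * (ennreal ?a * ennreal ?m)"
    using m by (simp add: ennreal_mult'[symmetric])
  also have "\<dots> \<le> mean_dev (qball d x r) g c" unfolding mean_dev_def
    using avg_diff_const_le[OF assms, of c] assms(2) by (intro mult_left_mono) (auto simp: emeasure_qball)
  finally show ?thesis .
qed

text \<open>
  Where the weights add up to 1, subtracting a constant from the smoothed function amounts to
  subtracting it from each average; for \<open>c = 0\<close> there is nothing to subtract.
\<close>

lemma smoothing_diff_const_le:
  fixes g :: "'a \<Rightarrow> 'b::{banach, second_countable_topology}"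
  assumes net: "averaging_net Q r E w" and r: "0 < r" and g: "integrable M g"
    and y: "y \<in> Q \<or> c = 0"
  shows "ennreal (norm (smoothing r E w g y - c))
    \<le> (\<Sum>i\<in>E. ennreal (w i y) * mean_dev (qball d i (r / (2 * K))) g c)"
proof -
  let ?a = "\<lambda>i. avg M (qball d i (r / (2 * K))) g"
  note w0 = averaging_netD(4)[OF net]
  have "smoothing r E w g y - c = (\<Sum>i\<in>E. w i y *\<^sub>R ?a i) - (\<Sum>i\<in>E. w i y) *\<^sub>R c"
    using y averaging_netD(7)[OF net] by (auto simp: smoothing_def)
  also have "\<dots> = (\<Sum>i\<in>E. w i y *\<^sub>R (?a i - c))"
    by (simp add: scaleR_diff_right sum_subtractf scaleR_sum_left)
  finally have "norm (smoothing r E w g y - c) \<le> (\<Sum>i\<in>E. norm (w i y *\<^sub>R (?a i - c)))"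
    by (simp only: norm_sum)
  also have "\<dots> = (\<Sum>i\<in>E. w i y * norm (?a i - c))" using w0 by simp
  finally have "ennreal (norm (smoothing r E w g y - c)) \<le> ennreal (\<Sum>i\<in>E. w i y * norm (?a i - c))"
    by (rule ennreal_leI)
  also have "\<dots> = (\<Sum>i\<in>E. ennreal (w i y) * ennreal (norm (?a i - c)))"
    using w0 by (simp add: ennreal_mult' sum_ennreal[symmetric])
  also have "\<dots> \<le> (\<Sum>i\<in>E. ennreal (w i y) * mean_dev (qball d i (r / (2 * K))) g c)"
    using r K_ge_1 by (intro sum_mono mult_left_mono avg_le_mean_dev integrable_imp_set_integrable[OF g]) auto
  finally show ?thesis .
qed

lemma smoothing_diff_const_le_sup:
  fixes g :: "'a \<Rightarrow> 'b::{banach, second_countable_topology}"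
  assumes net: "averaging_net Q r E w" and r: "0 < r" and g: "integrable M g"
    and y: "y \<in> Q \<or> c = 0"
    and a: "\<And>i. i \<in> E \<Longrightarrow> d i y < 2 * K * r \<Longrightarrow> mean_dev (qball d i (r / (2 * K))) g c \<le> a"
  shows "ennreal (norm (smoothing r E w g y - c)) \<le> a"
proof -
  have "ennreal (norm (smoothing r E w g y - c))
      \<le> (\<Sum>i\<in>E. ennreal (w i y) * mean_dev (qball d i (r / (2 * K))) g c)"
    by (rule smoothing_diff_const_le[OF net r g y])
  also have "\<dots> \<le> (\<Sum>i\<in>E. ennreal (w i y) * a)"
  proof (rule sum_mono)
    fix i assume i: "i \<in> E"
    show "ennreal (w i y) * mean_dev (qball d i (r / (2 * K))) g c \<le> ennreal (w i y) * a"
      using a[OF i] averaging_netD(5)[OF net, of i y] by (cases "w i y = 0") (auto intro: mult_left_mono)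
  qed
  also have "\<dots> = ennreal (\<Sum>i\<in>E. w i y) * a"
    using averaging_netD(4)[OF net] by (simp add: sum_distrib_right[symmetric] sum_ennreal)
  also have "\<dots> \<le> ennreal 1 * a"
    using averaging_netD(6)[OF net] by (intro mult_right_mono ennreal_leI) auto
  finally show ?thesis by simp
qed

text \<open>
  The pointwise form of locality, for balls below the scale \<open>r\<close>. With \<open>x = y\<close> and \<open>c = 0\<close> it bounds the
  smoothed function by averages over centred balls, hence by the maximal function.
\<close>

lemma smoothing_diff_const_le_ball:
  fixes g :: "'a \<Rightarrow> 'b::{banach, second_countable_topology}"
  assumes net: "averaging_net Q r E w" and r: "0 < r" and g: "integrable M g"
    and y: "y \<in> Q \<or> c = 0" and xy: "d x y < r"
  shows "ennreal (norm (smoothing r E w g y - c)) \<le> ennreal C * mean_dev (qball d x (4 * K^3 * r)) g c"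
proof (rule smoothing_diff_const_le_sup[OF net r g y])
  fix i assume i: "d i y < 2 * K * r"
  let ?B = "qball d x (4 * K^3 * r)" and ?b = "qball d i (r / (2 * K))"
  have pos: "4 * K^3 * r > 0" "r / (2 * K) > 0" using r K_ge_1 by auto
  have m: "measure M ?B > 0" "measure M ?b > 0" by (rule measure_qball_pos[OF pos(1)], rule measure_qball_pos[OF pos(2)])
  have "ennreal (measure M ?B) \<le> ennreal (C * measure M ?b)"
    using comparable_small_ball[OF r xy i] C_ge_1
    by (simp add: emeasure_qball[OF pos(1)] emeasure_qball[OF pos(2)] ennreal_mult'')
  then have "measure M ?B \<le> C * measure M ?b" using C_ge_1 by (simp add: ennreal_le_iff)
  then have "1 / measure M ?b \<le> C * (1 / measure M ?B)" using m by (simp add: field_simps)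
  then have "ennreal (1 / measure M ?b) \<le> ennreal C * ennreal (1 / measure M ?B)"
    using C_ge_1 by (simp add: ennreal_mult'[symmetric] ennreal_leI)
  then have "mean_dev ?b g c \<le> (ennreal C * ennreal (1 / measure M ?B)) * (\<integral>\<^sup>+z\<in>?B. ennreal (norm (g z - c)) \<partial>M)"
    unfolding mean_dev_def using small_ball_subset(2)[OF r order_refl xy i]
    by (intro mult_mono nn_integral_mono) (auto simp: indicator_def)
  then show "mean_dev ?b g c \<le> ennreal C * mean_dev ?B g c" by (simp add: mean_dev_def mult.assoc)
qed

text \<open>
  The integrated form, for balls above the scale \<open>r\<close>. The integral of a weight is comparable with the
  measure of its averaging ball, which cancels the denominator of the mean; the averaging balls are
  disjoint, so the remaining integrals add up to at most one integral over \<open>P'\<close>.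
\<close>

lemma integral_net_mean_dev_le:
  fixes g :: "'a \<Rightarrow> 'b::{banach, second_countable_topology}"
  assumes net: "averaging_net Q r E w" and r: "0 < r" and g: "integrable M g"
    and P: "P \<in> sets M" "P' \<in> sets M"
    and sub: "\<And>i y. y \<in> P \<Longrightarrow> d i y < 2 * K * r \<Longrightarrow> qball d i (r / (2 * K)) \<subseteq> P'"
  shows "(\<integral>\<^sup>+y\<in>P. (\<Sum>i\<in>E. ennreal (w i y) * mean_dev (qball d i (r / (2 * K))) g c) \<partial>M)
    \<le> ennreal C * (\<integral>\<^sup>+y\<in>P'. ennreal (norm (g y - c)) \<partial>M)"
proof -
  note [measurable] = borel_measurable_integrable[OF g] P
  note fin = averaging_netD(1)[OF net]
  have w_meas: "w i \<in> borel_measurable M" if "i \<in> E" for i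
    by (rule continuous_borel_measurable[OF averaging_netD(3)[OF net that]])
  let ?\<beta> = "\<lambda>i. qball d i (r / (2 * K))"
  define I where "I i = (\<integral>\<^sup>+z\<in>?\<beta> i. ennreal (norm (g z - c)) \<partial>M)" for i
  define E' where "E' = {i\<in>E. \<exists>y\<in>P. d i y < 2 * K * r}"
  have pos: "r / (2 * K) > 0" using r K_ge_1 by auto
  have summand: "(\<integral>\<^sup>+y\<in>P. ennreal (w i y) * mean_dev (?\<beta> i) g c \<partial>M)
      \<le> (if i \<in> E' then ennreal C * I i else 0)" if i: "i \<in> E" for i
  proof -
    note [measurable] = w_meas[OF i]
    have w1: "w i y \<le> 1" for y
      using member_le_sum[of i E "\<lambda>i. w i y"] i fin averaging_netD(4)[OF net] averaging_netD(6)[OF net, of y]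
      by force
    show ?thesis
    proof (cases "i \<in> E'")
      case True
      have m: "measure M (?\<beta> i) > 0" by (rule measure_qball_pos[OF pos])
      have "(\<integral>\<^sup>+y\<in>P. ennreal (w i y) * mean_dev (?\<beta> i) g c \<partial>M)
          \<le> (\<integral>\<^sup>+y. mean_dev (?\<beta> i) g c * indicator (qball d i (2 * K * r)) y \<partial>M)"
      proof (rule nn_integral_mono)
        fix y
        show "ennreal (w i y) * mean_dev (?\<beta> i) g c * indicator P y
           \<le> mean_dev (?\<beta> i) g c * indicator (qball d i (2 * K * r)) y"
          using averaging_netD(5)[OF net, of i y] mult_right_mono[OF ennreal_leI[OF w1[of y]], of "mean_dev (?\<beta> i) g c"]
          by (cases "w i y = 0") (auto simp: indicator_def)
      qed
      also have "\<dots> = mean_dev (?\<beta> i) g c * emeasure M (qball d i (2 * K * r))"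
        by (rule nn_integral_cmult_indicator) simp
      also have "\<dots> \<le> mean_dev (?\<beta> i) g c * (ennreal C * emeasure M (?\<beta> i))"
        by (intro mult_left_mono comparable_support r) auto
      also have "\<dots> = (ennreal (1 / measure M (?\<beta> i)) * ennreal (measure M (?\<beta> i))) * (ennreal C * I i)"
        unfolding mean_dev_def I_def emeasure_qball[OF pos] by (simp only: mult_ac)
      also have "ennreal (1 / measure M (?\<beta> i)) * ennreal (measure M (?\<beta> i)) = 1"
        using m by (simp add: ennreal_mult'[symmetric])
      finally show ?thesis using True by simp
    next
      case False
      then have "w i y = 0" if "y \<in> P" for y using averaging_netD(5)[OF net, of i y] i that
        by (auto simp: E'_def)
      then have "(\<integral>\<^sup>+y\<in>P. ennreal (w i y) * mean_dev (?\<beta> i) g c \<partial>M) = (\<integral>\<^sup>+y. 0 \<partial>M)"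
        by (intro nn_integral_cong) (auto simp: indicator_def)
      then show ?thesis by simp
    qed
  qed
  have "(\<integral>\<^sup>+y\<in>P. (\<Sum>i\<in>E. ennreal (w i y) * mean_dev (?\<beta> i) g c) \<partial>M)
      = (\<Sum>i\<in>E. \<integral>\<^sup>+y\<in>P. ennreal (w i y) * mean_dev (?\<beta> i) g c \<partial>M)"
    unfolding sum_distrib_right using w_meas by (intro nn_integral_sum) auto
  also have "\<dots> \<le> (\<Sum>i\<in>E. if i \<in> E' then ennreal C * I i else 0)" by (intro sum_mono summand)
  also have "\<dots> = (\<Sum>i\<in>E'. ennreal C * I i)"
    using fin by (intro sum.mono_neutral_cong_right) (auto simp: E'_def)
  also have "\<dots> = ennreal C * (\<Sum>i\<in>E'. I i)" by (rule sum_distrib_left[symmetric])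
  also have "(\<Sum>i\<in>E'. I i) = (\<integral>\<^sup>+z. (\<Sum>i\<in>E'. ennreal (norm (g z - c)) * indicator (?\<beta> i) z) \<partial>M)"
    unfolding I_def by (rule nn_integral_sum[symmetric]) auto
  also have "\<dots> \<le> (\<integral>\<^sup>+y\<in>P'. ennreal (norm (g y - c)) \<partial>M)"
  proof (rule nn_integral_mono)
    fix z
    have "disjoint_family_on ?\<beta> E'" using averaging_netD(2)[OF net]
      by (rule disjoint_family_on_mono[rotated]) (auto simp: E'_def)
    then have "(\<Sum>i\<in>E'. indicator (?\<beta> i) z) = (indicator (\<Union>i\<in>E'. ?\<beta> i) z :: ennreal)"
      using fin by (intro indicator_UN_disjoint[symmetric]) (auto simp: E'_def)
    also have "\<dots> \<le> indicator P' z"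
    proof -
      have "?\<beta> i \<subseteq> P'" if "i \<in> E'" for i using that sub unfolding E'_def by blast
      then have "(\<Union>i\<in>E'. ?\<beta> i) \<subseteq> P'" by blast
      then show ?thesis by (intro indicator_leI) (rule subsetD)
    qed
    finally show "(\<Sum>i\<in>E'. ennreal (norm (g z - c)) * indicator (?\<beta> i) z)
        \<le> ennreal (norm (g z - c)) * indicator P' z"
      unfolding sum_distrib_left[symmetric] by (intro mult_left_mono) auto
  qed
  finally show ?thesis by (simp add: mult_left_mono)
qed

lemma smoothing_L1_le:
  fixes g :: "'a \<Rightarrow> 'b::{banach, second_countable_topology}"
  assumes net: "averaging_net Q r E w" and r: "0 < r" and g: "integrable M g"
  shows "(\<integral>\<^sup>+y. ennreal (norm (smoothing r E w g y)) \<partial>M) \<le> ennreal C * (\<integral>\<^sup>+y. ennreal (norm (g y)) \<partial>M)"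
proof -
  have "(\<integral>\<^sup>+y. ennreal (norm (smoothing r E w g y)) \<partial>M)
     \<le> (\<integral>\<^sup>+y\<in>UNIV. (\<Sum>i\<in>E. ennreal (w i y) * mean_dev (qball d i (r / (2 * K))) g 0) \<partial>M)"
    using smoothing_diff_const_le[OF net r g, of _ 0] by (intro nn_integral_mono) auto
  also have "\<dots> \<le> ennreal C * (\<integral>\<^sup>+y\<in>UNIV. ennreal (norm (g y - 0)) \<partial>M)"
    using sets.top[of M] by (intro integral_net_mean_dev_le[OF net r g]) auto
  finally show ?thesis by simp
qed

lemma smoothing_support:
  fixes g :: "'a \<Rightarrow> 'b::{banach, second_countable_topology}"
  assumes net: "averaging_net Q r E w" and r: "0 < r" "r \<le> 1"
    and g: "\<And>z. z \<notin> qball d x0 R \<Longrightarrow> g z = 0" and y: "smoothing r E w g y \<noteq> 0"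
  shows "d x0 y < K^2 * (R + 3)"
proof -
  obtain i where i: "i \<in> E" "w i y \<noteq> 0" "avg M (qball d i (r / (2 * K))) g \<noteq> 0"
    using y unfolding smoothing_def by (auto elim!: sum.not_neutral_contains_not_neutral)
  have iy: "d i y < 2 * K * r" by (rule averaging_netD(5)[OF net i(2)])
  have "\<exists>z\<in>qball d i (r / (2 * K)). g z \<noteq> 0"
  proof (rule ccontr)
    assume "\<not> ?thesis"
    then have "(\<lambda>z. indicator (qball d i (r / (2 * K))) z *\<^sub>R g z) = (\<lambda>z. 0)"
      by (auto simp: indicator_def fun_eq_iff)
    then show False using i(3) by (simp add: avg_def set_lebesgue_integral_def)
  qed
  then obtain z where z: "d i z < r / (2 * K)" "g z \<noteq> 0" by auto
  then have zR: "d x0 z < R" using g[of z] by auto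
  have rK: "r / (2 * K) \<le> 1" using r K_ge_1 by (simp add: field_simps)
  have zi: "d z i \<le> 1" using z(1) rK symmetric[of z i] by linarith
  have "d x0 i \<le> K * (d x0 z + d z i)" by (rule triangle)
  also have "\<dots> \<le> K * (R + 1)" using zR zi K_ge_1 by (intro mult_left_mono) auto
  finally have i0: "d x0 i \<le> K * (R + 1)" .
  have "d x0 y \<le> K * (d x0 i + d i y)" by (rule triangle)
  also have "\<dots> < K * (K * (R + 1) + 2 * K * r)" using i0 iy K_ge_1 by (intro mult_strict_left_mono) auto
  also have "\<dots> = K^2 * (R + 1 + 2 * r)" by (simp add: algebra_simps power2_eq_square)
  also have "\<dots> \<le> K^2 * (R + 3)" using r by (intro mult_left_mono) auto
  finally show ?thesis .
qed

text \<open>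
  On a ball of radius \<open>s < r\<close> the smoothed function stays close to a single constant pointwise; on a ball
  of radius \<open>s \<ge> r\<close> its deviation is controlled by that of \<open>g\<close> on a dilated ball. The region on which
  the weights add up to 1 is taken much larger than the support of \<open>g\<close>: a ball of radius at most 1 that
  leaves this region cannot meet the support of the smoothed function.
\<close>

lemma osc_bounded_smoothing:
  fixes g :: "'a \<Rightarrow> 'b::{banach, second_countable_topology}"
  assumes net: "averaging_net (qball d x0 (K^3 * (R + 5))) r E w" and r: "0 < r" "r \<le> 1" and R: "0 < R"
    and g: "integrable M g" and supp: "\<And>z. z \<notin> qball d x0 R \<Longrightarrow> g z = 0"
    and osc: "osc_bounded d M g b"
  shows "osc_bounded d M (smoothing r E w g) (ennreal (C * (C + 1)) * b)"
  unfolding osc_bounded_def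
proof (intro allI impI)
  fix x and s :: real assume s: "0 < s"
  let ?Q = "qball d x0 (K^3 * (R + 5))" and ?S = "smoothing r E w g"
  let ?B = "qball d x s"
  have K3: "1 \<le> K^3" "K^2 \<le> K^3" using K_ge_1 power_increasing[of 2 3 K] by (auto simp: one_le_power)
  have gsupp: "d x0 y < K^2 * (R + 3)" if "?S y \<noteq> 0" for y
    by (rule smoothing_support[OF net r supp that])
  have R_le: "R \<le> K^3 * (R + 5)" using mult_mono[of 1 "K^3" R "R + 5"] K3 R K_ge_1 by simp
  have R2_le: "K^2 * (R + 3) \<le> K^3 * (R + 5)" using K3 R K_ge_1 by (intro mult_mono) auto
  note [measurable] = borel_measurable_integrable[OF g] measurable_smoothing[OF net, of g]
  show "\<exists>c. (\<integral>\<^sup>+y\<in>?B. ennreal (norm (?S y - c)) \<partial>M) \<le> ennreal (C * (C + 1)) * b * emeasure M ?B"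
  proof (cases "s < r")
    case True
    show ?thesis
    proof (cases "?B \<subseteq> ?Q")
      case inQ: True
      let ?B' = "qball d x (4 * K^3 * r)"
      have pos: "4 * K^3 * r > 0" using r K_ge_1 by simp
      obtain c where c: "(\<integral>\<^sup>+y\<in>?B'. ennreal (norm (g y - c)) \<partial>M) \<le> b * emeasure M ?B'"
        using osc_boundedE[OF osc pos] by blast
      have "mean_dev ?B' g c \<le> ennreal (1 / measure M ?B') * (b * emeasure M ?B')"
        unfolding mean_dev_def by (intro mult_left_mono c) auto
      also have "\<dots> = (ennreal (1 / measure M ?B') * ennreal (measure M ?B')) * b"
        unfolding emeasure_qball[OF pos] by (simp only: mult_ac)
      also have "\<dots> = b" using measure_qball_pos[OF pos, of x] by (simp add: ennreal_mult'[symmetric])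
      finally have md: "mean_dev ?B' g c \<le> b" .
      have pt: "ennreal (norm (?S y - c)) \<le> ennreal C * b" if "y \<in> ?B" for y
      proof -
        have "y \<in> ?Q \<or> c = 0" "d x y < r" using inQ that True by auto
        from smoothing_diff_const_le_ball[OF net r(1) g this]
        show ?thesis by (rule order_trans) (intro mult_left_mono md, simp)
      qed
      have "(\<integral>\<^sup>+y\<in>?B. ennreal (norm (?S y - c)) \<partial>M) \<le> (\<integral>\<^sup>+y. ennreal C * b * indicator ?B y \<partial>M)"
        using pt by (intro nn_integral_mono) (auto simp: indicator_def)
      also have "\<dots> = ennreal C * b * emeasure M ?B" by (rule nn_integral_cmult_indicator) simp
      also have "\<dots> \<le> ennreal (C * (C + 1)) * b * emeasure M ?B"
        using C_ge_1 by (intro mult_right_mono ennreal_leI) auto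
      finally show ?thesis by blast
    next
      case False
      then obtain z where "z \<in> ?B" "z \<notin> ?Q" by blast
      then have z: "d x z < s" "K^3 * (R + 5) \<le> d x0 z" by auto
      have zero: "?S y = 0" if y: "y \<in> ?B" for y
      proof (rule ccontr)
        assume "?S y \<noteq> 0"
        then have y0: "d x0 y < K^2 * (R + 3)" by (rule gsupp)
        have "d y z \<le> K * (d y x + d x z)" by (rule triangle)
        also have "\<dots> \<le> K * (1 + 1)" using z y True r symmetric[of x y] K_ge_1 by (intro mult_left_mono) auto
        finally have yz: "d y z \<le> 2 * K" by simp
        have "d x0 z \<le> K * (d x0 y + d y z)" by (rule triangle)
        also have "\<dots> < K * (K^2 * (R + 3) + 2 * K)" using y0 yz K_ge_1 by (intro mult_strict_left_mono) auto
        also have "\<dots> = K^3 * (R + 3) + 2 * K^2" by (simp add: algebra_simps power2_eq_square power3_eq_cube)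
        also have "\<dots> \<le> K^3 * (R + 5)" using K3 by (simp add: algebra_simps)
        finally show False using z by simp
      qed
      have "(\<integral>\<^sup>+y\<in>?B. ennreal (norm (?S y - 0)) \<partial>M) = (\<integral>\<^sup>+y. 0 \<partial>M)"
        using zero by (intro nn_integral_cong) (auto simp: indicator_def)
      then show ?thesis by (intro exI[of _ 0]) simp
    qed
  next
    case False
    then have rs: "r \<le> s" by simp
    \<comment> \<open>Outside the region where the weights add up to 1, both functions vanish, and the deviation of \<open>g\<close>
      itself takes the place of the sum; this is why it is added on the right-hand side.\<close>
    let ?B' = "qball d x (4 * K^3 * s)"
    have pos: "4 * K^3 * s > 0" using s K_ge_1 by simp
    have "s \<le> 4 * K^3 * s" using mult_right_mono[of 1 "4 * K^3" s] s K3 by simp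
    then have BB': "?B \<subseteq> ?B'" by auto
    obtain c where c: "(\<integral>\<^sup>+y\<in>?B'. ennreal (norm (g y - c)) \<partial>M) \<le> b * emeasure M ?B'"
      using osc_boundedE[OF osc pos] by blast
    let ?A = "\<lambda>y. \<Sum>i\<in>E. ennreal (w i y) * mean_dev (qball d i (r / (2 * K))) g c"
    have w_meas [measurable]: "w i \<in> borel_measurable M" if "i \<in> E" for i
      by (rule continuous_borel_measurable[OF averaging_netD(3)[OF net that]])
    have pt: "ennreal (norm (?S y - c)) \<le> ?A y + ennreal (norm (g y - c))" for y
    proof (cases "y \<in> ?Q")
      case True
      then show ?thesis
        using smoothing_diff_const_le[OF net r(1) g, of y c] by (simp add: add_increasing2)
    next
      case nQ: False
      then have "?S y = 0" using gsupp[of y] R2_le by force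
      moreover have "g y = 0" using nQ R_le by (intro supp) auto
      ultimately show ?thesis by (simp add: add_increasing)
    qed
    have "(\<integral>\<^sup>+y\<in>?B. ennreal (norm (?S y - c)) \<partial>M)
        \<le> (\<integral>\<^sup>+y. ?A y * indicator ?B y + ennreal (norm (g y - c)) * indicator ?B y \<partial>M)"
      using pt by (intro nn_integral_mono) (auto simp: indicator_def)
    also have "\<dots> = (\<integral>\<^sup>+y\<in>?B. ?A y \<partial>M) + (\<integral>\<^sup>+y\<in>?B. ennreal (norm (g y - c)) \<partial>M)"
      by (rule nn_integral_add) auto
    also have "\<dots> \<le> ennreal C * (\<integral>\<^sup>+y\<in>?B'. ennreal (norm (g y - c)) \<partial>M) + (\<integral>\<^sup>+y\<in>?B'. ennreal (norm (g y - c)) \<partial>M)"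
      using small_ball_subset(2)[OF r(1) rs] BB'
      by (intro add_mono integral_net_mean_dev_le[OF net r(1) g] nn_integral_mono)
        (auto simp: indicator_def)
    also have "\<dots> = ennreal (C + 1) * (\<integral>\<^sup>+y\<in>?B'. ennreal (norm (g y - c)) \<partial>M)"
      using C_ge_1 by (simp add: ennreal_plus distrib_right)
    also have "\<dots> \<le> ennreal (C + 1) * (b * (ennreal C * emeasure M ?B))"
      by (intro mult_left_mono order_trans[OF c] comparable_dilate s) auto
    also have "\<dots> = ennreal (C * (C + 1)) * b * emeasure M ?B"
      using C_ge_1 by (simp add: ennreal_mult' mult_ac)
    finally show ?thesis by blast
  qed
qed


section \<open>Cutoffs of small oscillation\<close>

lemma measure_qball_mono: "r \<le> s \<Longrightarrow> measure M (qball d x r) \<le> measure M (qball d x s)"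
proof (cases "0 < s")
  case True
  assume "r \<le> s"
  then show ?thesis
    using emeasure_qball[OF True, of x] by (intro measure_mono_fmeasurable qball_mono) (auto intro!: fmeasurableI)
next
  case False
  assume "r \<le> s"
  then have "qball d x r = {}" using False nonneg[of x] by (auto simp: qball_def not_less intro: order_trans)
  then show ?thesis by simp
qed

text \<open>
  A point \<open>y\<close> far away has a ball around it disjoint from the ball of comparable size around \<open>x\<close>; by
  doubling it carries a fixed fraction of the measure of the latter.
\<close>

lemma ex_larger_ball_measure:
  assumes unb: "\<And>R. \<exists>y. R \<le> d x y"
  shows "\<exists>\<delta>>0. \<forall>R>0. \<exists>R'\<ge>R. (1 + \<delta>) * measure M (qball d x R) \<le> measure M (qball d x R')"
proof -
  obtain D where D: "D \<ge> 1" "\<And>x y r. 0 < r \<Longrightarrow> d x y \<le> (2 * K) * r \<Longrightarrow>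
     emeasure M (qball d x ((2 * K) * r)) \<le> ennreal D * emeasure M (qball d y r)"
    using doubling_comparable[of "2 * K"] by blast
  show ?thesis
  proof (rule exI[of _ "1 / D"], intro conjI allI impI)
    show "0 < 1 / D" using D by simp
    fix R :: real assume R: "0 < R"
    obtain y where y: "2 * K * R \<le> d x y" using unb by blast
    define t where "t = d x y / (2 * K)"
    have xy: "d x y = (2 * K) * t" using K_ge_1 by (simp add: t_def)
    have tR: "R \<le> t" using y K_ge_1 by (simp add: t_def field_simps)
    have t: "0 < t" using tR R by simp
    define R' where "R' = K * (d x y + t)"
    have "1 * t \<le> K * (d x y + t)" using K_ge_1 t nonneg[of x y] by (intro mult_mono) auto
    then have tR': "t \<le> R'" by (simp add: R'_def)
    have m0: "measure M (qball d x t) \<le> D * measure M (qball d y t)"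
    proof -
      have "t \<le> 2 * K * t" using K_ge_1 t by simp
      then have "emeasure M (qball d x t) \<le> emeasure M (qball d x ((2 * K) * t))"
        by (intro emeasure_mono qball_mono) auto
      also have "\<dots> \<le> ennreal D * emeasure M (qball d y t)" using D(2)[OF t, of x y] xy by simp
      finally show ?thesis using D(1) by (simp add: emeasure_qball[OF t] ennreal_mult''[symmetric])
    qed
    have fm: "qball d z u \<in> fmeasurable M" if "0 < u" for z u
      using emeasure_qball[OF that, of z] by (auto intro!: fmeasurableI)
    have R': "0 < R'" using tR' t by simp
    have "qball d x t \<inter> qball d y t = {}"
      using separated_balls_disjoint[of "d x y" x y] by (simp add: t_def)
    then have "measure M (qball d x t) + measure M (qball d y t) = measure M (qball d x t \<union> qball d y t)"
      using measure_Un3[OF fm[OF t] fm[OF t], of x y] by simp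
    also have "\<dots> \<le> measure M (qball d x R')"
    proof (rule measure_mono_fmeasurable[OF _ _ fm[OF R']])
      show "qball d x t \<union> qball d y t \<subseteq> qball d x R'"
        using qball_mono[OF tR', of x] qball_subset[of x y "d x y" t R'] by (simp add: R'_def)
    qed simp
    finally have "measure M (qball d x t) + measure M (qball d y t) \<le> measure M (qball d x R')" .
    moreover have "1 / D * measure M (qball d x t) \<le> measure M (qball d y t)"
      using m0 D(1) by (simp add: field_simps)
    ultimately have "(1 + 1 / D) * measure M (qball d x t) \<le> measure M (qball d x R')"
      by (simp add: algebra_simps)
    moreover have "(1 + 1 / D) * measure M (qball d x R) \<le> (1 + 1 / D) * measure M (qball d x t)"
      using D(1) by (intro mult_left_mono measure_qball_mono tR) auto
    ultimately show "\<exists>R'\<ge>R. (1 + 1 / D) * measure M (qball d x R) \<le> measure M (qball d x R')"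
      using tR tR' by (intro exI[of _ R']) auto
  qed
qed

lemma ex_doubling_radius:
  assumes unb: "\<And>R. \<exists>y. R \<le> d x y" and R: "0 < R" and L: "1 \<le> L"
  shows "\<exists>R'\<ge>L * R. 2 * measure M (qball d x R) \<le> measure M (qball d x R')"
proof -
  obtain \<delta> where \<delta>: "\<delta> > 0" "\<And>R. 0 < R \<Longrightarrow> \<exists>R'\<ge>R. (1 + \<delta>) * measure M (qball d x R) \<le> measure M (qball d x R')"
    using ex_larger_ball_measure[OF unb] by blast
  have iter: "\<exists>R'\<ge>L * R. (1 + \<delta>)^n * measure M (qball d x (L * R)) \<le> measure M (qball d x R')" for n
  proof (induction n)
    case (Suc n)
    then obtain S where S: "L * R \<le> S" "(1 + \<delta>)^n * measure M (qball d x (L * R)) \<le> measure M (qball d x S)" by blast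
    have "0 < L * R" using R L by simp
    then obtain R' where R': "R' \<ge> S" "(1 + \<delta>) * measure M (qball d x S) \<le> measure M (qball d x R')"
      using \<delta>(2)[of S] S(1) by auto
    have "(1 + \<delta>)^Suc n * measure M (qball d x (L * R)) \<le> (1 + \<delta>) * measure M (qball d x S)"
      using mult_left_mono[OF S(2), of "1 + \<delta>"] \<delta>(1) by (simp add: mult.assoc)
    then show ?case using S(1) R' by (intro exI[of _ R']) auto
  qed auto
  obtain n where n: "2 < (1 + \<delta>)^n" using real_arch_pow[of "1 + \<delta>" 2] \<delta>(1) by auto
  obtain R' where R': "R' \<ge> L * R" "(1 + \<delta>)^n * measure M (qball d x (L * R)) \<le> measure M (qball d x R')"
    using iter by blast
  have "R \<le> L * R" using R L by simp
  then have "2 * measure M (qball d x R) \<le> (1 + \<delta>)^n * measure M (qball d x (L * R))"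
    using n by (intro mult_mono measure_qball_mono) auto
  then show ?thesis using R' by (intro exI[of _ R']) auto
qed

text \<open>
  The cutoff descends from 1 to 0 in \<open>m\<close> equal steps, at radii \<open>\<rho> i\<close> that grow so fast that the measures
  of the balls at least double. A ball that is far from \<open>x0\<close> compared with its radius meets at most one
  step, so the oscillation there is at most \<open>1 / m\<close>. A ball near \<open>x0\<close> is comparable with a ball around
  \<open>x0\<close>; the steps outside are not seen, and those inside take place on sets whose measures form a
  geometric series, so that on average they contribute a multiple of \<open>1 / m\<close>. The radii are chosen by
  measure and not only by distance because doubling gives no lower bound for the growth of the measure
  from one radius to the next: annuli can be empty. If the space is a ball, the constant 1 is a cutoff.
\<close>

lemma ex_slow_cutoff:
  assumes R: "0 < R" and \<epsilon>: "0 < \<epsilon>"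
  shows "\<exists>\<eta> :: 'a \<Rightarrow> real. \<eta> \<in> borel_measurable M \<and> (\<forall>y. 0 \<le> \<eta> y \<and> \<eta> y \<le> 1) \<and>
    (\<forall>y\<in>qball d x0 R. \<eta> y = 1) \<and> (\<exists>R'>0. \<forall>y. y \<notin> qball d x0 R' \<longrightarrow> \<eta> y = 0) \<and>
    osc_bounded d M \<eta> (ennreal \<epsilon>)"
proof (cases "\<forall>R. \<exists>y. R \<le> d x0 y")
  case False
  then obtain R' where R': "\<And>y. d x0 y < R'" by (auto simp: not_le)
  have "0 < R'" using R'[of x0] by simp
  moreover have "osc_bounded d M (\<lambda>y. 1 :: real) (ennreal \<epsilon>)"
    unfolding osc_bounded_def by (auto intro!: exI[of _ 1])
  ultimately show ?thesis using R' by (intro exI[of _ "\<lambda>y. 1"]) auto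
next
  case True
  have K2: "1 \<le> 4 * K^2" using one_le_power[OF K_ge_1, of 2] by linarith
  let ?a = "\<lambda>u. measure M (qball d x0 u)"
  have "\<exists>\<rho>. \<forall>n. (R \<le> \<rho> n) \<and> (4 * K^2 * \<rho> n \<le> \<rho> (Suc n) \<and> 2 * ?a (\<rho> n) \<le> ?a (\<rho> (Suc n)))"
  proof (rule dependent_nat_choice)
    fix u and n :: nat assume u: "R \<le> u"
    then have u0: "0 < u" using R by simp
    then obtain u' where u': "4 * K^2 * u \<le> u'" "2 * ?a u \<le> ?a u'"
      using ex_doubling_radius[of x0 u "4 * K^2"] True K2 by auto
    have "u \<le> 4 * K^2 * u" using K2 u0 by simp
    then show "\<exists>v. R \<le> v \<and> (4 * K^2 * u \<le> v \<and> 2 * ?a u \<le> ?a v)" using u u' by (intro exI[of _ u']) auto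
  qed auto
  then obtain \<rho> where \<rho>: "\<And>n. R \<le> \<rho> n" "\<And>n. 4 * K^2 * \<rho> n \<le> \<rho> (Suc n)"
    "\<And>n. 2 * ?a (\<rho> n) \<le> ?a (\<rho> (Suc n))" by blast
  have \<rho>0: "0 < \<rho> n" for n using \<rho>(1)[of n] R by simp
  have mono: "\<rho> i \<le> \<rho> k" if "i \<le> k" for i k
  proof (rule lift_Suc_mono_le[OF _ that])
    fix n
    have "\<rho> n \<le> 4 * K^2 * \<rho> n" using K2 \<rho>0[of n] by simp
    then show "\<rho> n \<le> \<rho> (Suc n)" using \<rho>(2)[of n] by linarith
  qed
  have gap: "4 * K^2 * \<rho> i \<le> \<rho> k" if "i < k" for i k
    using \<rho>(2)[of i] mono[of "Suc i" k] that by linarith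
  have geometric: "(\<Sum>i\<le>n. ?a (\<rho> i)) \<le> 2 * ?a (\<rho> n)" for n
  proof (induction n)
    case (Suc n)
    then show ?case using \<rho>(3)[of n] by simp
  qed simp
  define L where "L = 3 * K^2"
  obtain D where D: "D \<ge> 1" "\<And>x y r. 0 < r \<Longrightarrow> d x y \<le> L * r \<Longrightarrow>
     emeasure M (qball d x (L * r)) \<le> ennreal D * emeasure M (qball d y r)"
    using doubling_comparable[of L] by blast
  \<comment> \<open>Enough steps for both cases: the mean oscillation is at most \<open>1 / m\<close> on far balls and at most
    \<open>2 * D / m\<close> on near ones.\<close>
  obtain m :: nat where m: "2 * D / \<epsilon> < real m" using reals_Archimedean2 by blast
  have "0 < 2 * D / \<epsilon>" using D \<epsilon> by simp
  then have m0: "0 < real m" using m by linarith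
  have mD: "2 * D / real m \<le> \<epsilon>" using m m0 \<epsilon> by (simp add: field_simps)
  then have m1: "1 / real m \<le> \<epsilon>" using D m0 divide_right_mono[of 1 "2 * D" "real m"] by linarith
  define \<eta> where "\<eta> y = (\<Sum>i<m. indicator (qball d x0 (\<rho> i)) y) / real m" for y
  have "osc_bounded d M \<eta> (ennreal \<epsilon>)"
    unfolding osc_bounded_def
  proof (intro allI impI)
    fix x and s :: real assume s: "0 < s"
    let ?B = "qball d x s"
    define D0 where "D0 = d x0 x"
    show "\<exists>c. (\<integral>\<^sup>+y\<in>?B. ennreal (norm (\<eta> y - c)) \<partial>M) \<le> ennreal \<epsilon> * emeasure M ?B"
    proof (cases "2 * K * s \<le> D0")
      case far: True
      define lo hi where "lo = D0 / (2 * K)" and "hi = 2 * K * D0"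
      have hi: "hi = 4 * K^2 * lo" using K_ge_1 by (simp add: lo_def hi_def power2_eq_square)
      have s_lo: "s \<le> lo" using far K_ge_1 by (simp add: lo_def field_simps)
      have D0: "D0 = 2 * K * lo" using K_ge_1 by (simp add: lo_def)
      \<comment> \<open>The steps that the ball can meet lie between \<open>lo\<close> and \<open>hi\<close>. Consecutive radii grow by the factor
        \<open>hi / lo\<close> at least, so there is at most one.\<close>
      define Z where "Z = {i\<in>{..<m}. lo < \<rho> i \<and> \<rho> i \<le> hi}"
      have "card Z \<le> Suc 0"
      proof (subst card_le_Suc0_iff_eq)
        show "\<forall>i\<in>Z. \<forall>k\<in>Z. i = k"
        proof (intro ballI)
          fix i k assume ik: "i \<in> Z" "k \<in> Z"
          have no: False if "i < k" "i \<in> Z" "k \<in> Z" for i k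
          proof -
            have "hi < 4 * K^2 * \<rho> i" using that K_ge_1 by (simp add: hi Z_def)
            then show False using gap[OF that(1)] that(3) by (simp add: Z_def)
          qed
          then show "i = k" using ik by (metis linorder_neqE_nat)
        qed
      qed (simp add: Z_def)
      then have Z1: "real (card Z) \<le> 1" by simp
      define c where "c = (\<Sum>i<m. if hi < \<rho> i then 1 else 0) / real m"
      have pt: "norm (\<eta> y - c) \<le> \<epsilon>" if y: "y \<in> ?B" for y
      proof -
        have xy: "d x y < s" using y by simp
        have "D0 \<le> K * (d x0 y + d y x)" unfolding D0_def by (rule triangle)
        also have "\<dots> \<le> K * (d x0 y + lo)"
          using xy s_lo symmetric[of x y] K_ge_1 by (intro mult_left_mono) auto
        finally have "K * (2 * lo) \<le> K * (d x0 y + lo)" by (simp add: D0)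
        then have ylo: "lo \<le> d x0 y" using K_ge_1 by simp
        have "d x0 y \<le> K * (D0 + d x y)" unfolding D0_def by (rule triangle)
        also have "\<dots> \<le> K * (D0 + D0)"
        proof (intro mult_left_mono add_left_mono)
          have "lo \<le> D0" using K_ge_1 s s_lo by (simp add: D0)
          then show "d x y \<le> D0" using xy s_lo by linarith
        qed (use K_ge_1 in simp)
        finally have yhi: "d x0 y \<le> hi" by (simp add: hi_def)
        have "\<eta> y - c = (\<Sum>i<m. indicator (qball d x0 (\<rho> i)) y - (if hi < \<rho> i then 1 else 0)) / real m"
          by (simp add: \<eta>_def c_def sum_subtractf diff_divide_distrib)
        moreover have "\<bar>\<Sum>i<m. indicator (qball d x0 (\<rho> i)) y - (if hi < \<rho> i then 1 else 0 :: real)\<bar>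
            \<le> (\<Sum>i<m. indicator Z i)"
          by (rule order_trans[OF sum_abs sum_mono]) (use ylo yhi in \<open>auto simp: indicator_def Z_def\<close>)
        moreover have "(\<Sum>i<m. indicator Z i) = real (card Z)"
        proof -
          have "(\<Sum>i<m. indicator Z i) = (\<Sum>i\<in>Z. 1 :: real)"
            by (intro sum.mono_neutral_cong_right) (auto simp: Z_def indicator_def)
          then show ?thesis by simp
        qed
        ultimately have "norm (\<eta> y - c) \<le> 1 / real m"
          using Z1 m0 by (simp add: divide_right_mono)
        then show ?thesis using m1 by linarith
      qed
      have "(\<integral>\<^sup>+y\<in>?B. ennreal (norm (\<eta> y - c)) \<partial>M) \<le> (\<integral>\<^sup>+y. ennreal \<epsilon> * indicator ?B y \<partial>M)"
        using pt by (intro nn_integral_mono) (auto simp: indicator_def intro!: ennreal_leI)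
      also have "\<dots> = ennreal \<epsilon> * emeasure M ?B" by (rule nn_integral_cmult_indicator) simp
      finally show ?thesis by blast
    next
      case False
      define T where "T = L * s"
      have KK: "K \<le> K^2" using K_ge_1 power_increasing[of 1 2 K] by simp
      have near: "d x0 x \<le> 2 * K * s" using False by (simp add: D0_def)
      have "2 * K * s \<le> L * s" using KK K_ge_1 s unfolding L_def by (intro mult_right_mono) auto
      then have "emeasure M (qball d x0 T) \<le> ennreal D * emeasure M ?B"
        unfolding T_def using near by (intro D(2) s) auto
      moreover have T0: "0 < T" unfolding T_def L_def using s K_ge_1 by simp
      ultimately have T_meas: "?a T \<le> D * measure M ?B"
        using D(1) by (simp add: emeasure_qball[OF T0] emeasure_qball[OF s] ennreal_mult''[symmetric])
      have "K * (2 * K * s + s) = 2 * K^2 * s + K * s" by (simp add: algebra_simps power2_eq_square)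
      also have "\<dots> \<le> T" using mult_right_mono[OF KK, of s] s by (simp add: T_def L_def)
      finally have BT: "?B \<subseteq> qball d x0 T" by (rule qball_subset[OF near])
      define J where "J = {i\<in>{..<m}. \<rho> i < T}"
      have J: "finite J" by (simp add: J_def)
      have sumJ: "(\<Sum>i\<in>J. ?a (\<rho> i)) \<le> 2 * ?a T"
      proof (cases "J = {}")
        case False
        define n where "n = Max J"
        have n: "n \<in> J" "J \<subseteq> {..n}" using J False by (auto simp: n_def)
        have "(\<Sum>i\<in>J. ?a (\<rho> i)) \<le> (\<Sum>i\<le>n. ?a (\<rho> i))" using n(2) by (intro sum_mono2) auto
        also have "\<dots> \<le> 2 * ?a (\<rho> n)" by (rule geometric)
        also have "\<dots> \<le> 2 * ?a T" using n(1) measure_qball_mono[of "\<rho> n" T x0] by (simp add: J_def)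
        finally show ?thesis .
      qed simp
      define c where "c = (\<Sum>i<m. if T \<le> \<rho> i then 1 else 0) / real m"
      have pt: "norm (\<eta> y - c) = (\<Sum>i\<in>J. 1 / real m * indicator (qball d x0 (\<rho> i)) y)" if y: "y \<in> ?B" for y
      proof -
        have yT: "d x0 y < T" using y BT by auto
        have "\<eta> y - c = (\<Sum>i<m. indicator (qball d x0 (\<rho> i)) y - (if T \<le> \<rho> i then 1 else 0)) / real m"
          by (simp add: \<eta>_def c_def sum_subtractf diff_divide_distrib)
        also have "(\<Sum>i<m. indicator (qball d x0 (\<rho> i)) y - (if T \<le> \<rho> i then 1 else 0 :: real))
            = (\<Sum>i\<in>J. indicator (qball d x0 (\<rho> i)) y)"
          using yT by (intro sum.mono_neutral_cong_right) (auto simp: J_def indicator_def)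
        finally have "\<eta> y - c = (\<Sum>i\<in>J. 1 / real m * indicator (qball d x0 (\<rho> i)) y)"
          by (simp add: sum_divide_distrib)
        moreover have "0 \<le> (\<Sum>i\<in>J. 1 / real m * indicator (qball d x0 (\<rho> i)) y)"
          by (intro sum_nonneg) auto
        ultimately show ?thesis by simp
      qed
      have "(\<integral>\<^sup>+y\<in>?B. ennreal (norm (\<eta> y - c)) \<partial>M)
          \<le> (\<integral>\<^sup>+y. (\<Sum>i\<in>J. ennreal (1 / real m) * indicator (qball d x0 (\<rho> i)) y) \<partial>M)"
      proof (rule nn_integral_mono)
        fix y
        have "(\<Sum>i\<in>J. ennreal (1 / real m) * indicator (qball d x0 (\<rho> i)) y)
           = (\<Sum>i\<in>J. ennreal (1 / real m * indicator (qball d x0 (\<rho> i)) y))"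
          by (intro sum.cong refl) (simp add: indicator_def)
        also have "\<dots> = ennreal (\<Sum>i\<in>J. 1 / real m * indicator (qball d x0 (\<rho> i)) y)"
          by (rule sum_ennreal) auto
        finally have eq: "(\<Sum>i\<in>J. ennreal (1 / real m) * indicator (qball d x0 (\<rho> i)) y)
            = ennreal (\<Sum>i\<in>J. 1 / real m * indicator (qball d x0 (\<rho> i)) y)" .
        show "ennreal (norm (\<eta> y - c)) * indicator ?B y
           \<le> (\<Sum>i\<in>J. ennreal (1 / real m) * indicator (qball d x0 (\<rho> i)) y)"
        proof (cases "y \<in> ?B")
          case True
          then show ?thesis unfolding pt[OF True] eq by (simp only: indicator_simps mult_1_right order_refl)
        qed simp
      qed
      also have "\<dots> = (\<Sum>i\<in>J. ennreal (1 / real m) * emeasure M (qball d x0 (\<rho> i)))"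
        by (subst nn_integral_sum) (auto simp: nn_integral_cmult_indicator)
      also have "\<dots> = (\<Sum>i\<in>J. ennreal (1 / real m * ?a (\<rho> i)))"
        unfolding emeasure_qball[OF \<rho>0] by (intro sum.cong refl ennreal_mult'[symmetric]) simp
      also have "\<dots> = ennreal (\<Sum>i\<in>J. 1 / real m * ?a (\<rho> i))"
        by (rule sum_ennreal) auto
      also have "\<dots> \<le> ennreal (\<epsilon> * measure M ?B)"
      proof (rule ennreal_leI)
        have "(\<Sum>i\<in>J. 1 / real m * ?a (\<rho> i)) = (\<Sum>i\<in>J. ?a (\<rho> i)) / real m" by (simp add: sum_divide_distrib)
        also have "\<dots> \<le> 2 * (D * measure M ?B) / real m" using sumJ T_meas by (intro divide_right_mono) auto
        also have "\<dots> = 2 * D / real m * measure M ?B" by simp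
        also have "\<dots> \<le> \<epsilon> * measure M ?B" using mD by (intro mult_right_mono) auto
        finally show "(\<Sum>i\<in>J. 1 / real m * ?a (\<rho> i)) \<le> \<epsilon> * measure M ?B" .
      qed
      also have "\<dots> = ennreal \<epsilon> * emeasure M ?B"
        using \<epsilon> by (simp add: emeasure_qball[OF s] ennreal_mult'')
      finally show ?thesis by blast
    qed
  qed
  moreover have "\<eta> \<in> borel_measurable M" unfolding \<eta>_def by measurable
  moreover have "0 \<le> \<eta> y \<and> \<eta> y \<le> 1" for y
  proof -
    have "(\<Sum>i<m. indicator (qball d x0 (\<rho> i)) y) \<le> (\<Sum>i<m. 1 :: real)"
      by (intro sum_mono) (auto simp: indicator_def)
    then show ?thesis using m0 by (auto simp: \<eta>_def sum_nonneg)
  qed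
  moreover have "\<eta> y = 1" if "y \<in> qball d x0 R" for y
  proof -
    have "indicator (qball d x0 (\<rho> i)) y = (1 :: real)" for i using that \<rho>(1)[of i] by (simp add: indicator_def)
    then show ?thesis using m0 by (simp add: \<eta>_def)
  qed
  moreover have "\<eta> y = 0" if "y \<notin> qball d x0 (\<rho> m)" for y
  proof -
    have "indicator (qball d x0 (\<rho> i)) y = (0 :: real)" if "i < m" for i
      using \<open>y \<notin> _\<close> mono[of i m] that by (simp add: indicator_def)
    then show ?thesis by (simp add: \<eta>_def)
  qed
  ultimately show ?thesis using \<rho>0[of m] by (intro exI[of _ \<eta>]) blast
qed


section \<open>Convergence of smoothings in the mean\<close>

text \<open>
  The region \<open>Q\<close> is fixed while the scale tends to 0, and the bound is uniform in the choice of
  the net, so that approximations of several functions can be compared on a common net.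
\<close>

definition approximable where
  "approximable Q g \<longleftrightarrow> (\<forall>e>0. \<exists>\<rho>>0. \<forall>r E w. 0 < r \<longrightarrow> r < \<rho> \<longrightarrow> averaging_net Q r E w \<longrightarrow>
    (\<integral>\<^sup>+y. ennreal (norm (smoothing r E w g y - g y)) \<partial>M) \<le> ennreal e)"

lemma approximableE:
  assumes "approximable Q g" "0 < e"
  obtains \<rho> where "\<rho> > 0" "\<And>r E w. 0 < r \<Longrightarrow> r < \<rho> \<Longrightarrow> averaging_net Q r E w \<Longrightarrow>
    (\<integral>\<^sup>+y. ennreal (norm (smoothing r E w g y - g y)) \<partial>M) \<le> ennreal e"
  using assms unfolding approximable_def by metis

lemma nn_integral_norm_add_le:
  fixes u v :: "'a \<Rightarrow> 'b::{banach, second_countable_topology}"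
  assumes [measurable]: "u \<in> borel_measurable M" "v \<in> borel_measurable M"
  shows "(\<integral>\<^sup>+y. ennreal (norm (u y + v y)) \<partial>M)
    \<le> (\<integral>\<^sup>+y. ennreal (norm (u y)) \<partial>M) + (\<integral>\<^sup>+y. ennreal (norm (v y)) \<partial>M)"
proof -
  have "(\<integral>\<^sup>+y. ennreal (norm (u y + v y)) \<partial>M) \<le> (\<integral>\<^sup>+y. ennreal (norm (u y)) + ennreal (norm (v y)) \<partial>M)"
    by (intro nn_integral_mono) (simp add: ennreal_plus[symmetric] norm_triangle_ineq del: ennreal_plus)
  also have "\<dots> = (\<integral>\<^sup>+y. ennreal (norm (u y)) \<partial>M) + (\<integral>\<^sup>+y. ennreal (norm (v y)) \<partial>M)"
    by (rule nn_integral_add) auto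
  finally show ?thesis .
qed

text \<open>
  Closedness in \<open>L\<^sup>1\<close>, because smoothing is bounded in \<open>L\<^sup>1\<close> uniformly in the scale.
\<close>

lemma approximable_by_approximable:
  fixes g :: "'a \<Rightarrow> 'b::{banach, second_countable_topology}"
  assumes g: "integrable M g"
    and h: "\<And>e. 0 < e \<Longrightarrow> \<exists>h. integrable M h \<and> approximable Q h \<and>
      (\<integral>\<^sup>+y. ennreal (norm (g y - h y)) \<partial>M) \<le> ennreal e"
  shows "approximable Q g"
  unfolding approximable_def
proof (intro allI impI)
  fix e :: real assume e: "0 < e"
  define e' where "e' = e / (C + 2)"
  have e': "0 < e'" "(C + 2) * e' = e" using e C_ge_1 by (auto simp: e'_def)
  obtain h where h: "integrable M h" "approximable Q h"
    "(\<integral>\<^sup>+y. ennreal (norm (g y - h y)) \<partial>M) \<le> ennreal e'"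
    using h[OF e'(1)] by blast
  obtain \<rho> where \<rho>: "\<rho> > 0" "\<And>r E w. 0 < r \<Longrightarrow> r < \<rho> \<Longrightarrow> averaging_net Q r E w \<Longrightarrow>
    (\<integral>\<^sup>+y. ennreal (norm (smoothing r E w h y - h y)) \<partial>M) \<le> ennreal e'"
    using approximableE[OF h(2) e'(1)] by blast
  show "\<exists>\<rho>>0. \<forall>r E w. 0 < r \<longrightarrow> r < \<rho> \<longrightarrow> averaging_net Q r E w \<longrightarrow>
    (\<integral>\<^sup>+y. ennreal (norm (smoothing r E w g y - g y)) \<partial>M) \<le> ennreal e"
  proof (intro exI[of _ \<rho>] conjI allI impI)
    fix r E w assume r: "0 < r" "r < \<rho>" and net: "averaging_net Q r E w"
    let ?S = "smoothing r E w"
    let ?k = "\<lambda>y. g y - h y"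
    have k: "integrable M ?k" using g h by auto
    note [measurable] = borel_measurable_integrable[OF g] borel_measurable_integrable[OF h(1)]
      measurable_smoothing[OF net, of g] measurable_smoothing[OF net, of h] measurable_smoothing[OF net, of ?k]
    have eq: "?S g y - g y = ?S ?k y + (?S h y - h y + (h y - g y))" for y
      by (simp add: smoothing_diff[OF g h(1)])
    have "(\<integral>\<^sup>+y. ennreal (norm (?S g y - g y)) \<partial>M)
      \<le> (\<integral>\<^sup>+y. ennreal (norm (?S ?k y)) \<partial>M) + ((\<integral>\<^sup>+y. ennreal (norm (?S h y - h y)) \<partial>M)
         + (\<integral>\<^sup>+y. ennreal (norm (h y - g y)) \<partial>M))"
      unfolding eq by (intro order_trans[OF nn_integral_norm_add_le] add_left_mono) measurable
    also have "\<dots> \<le> ennreal C * ennreal e' + (ennreal e' + ennreal e')"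
      using h(3) \<rho>(2)[OF r net] norm_minus_commute[of "h _"]
      by (intro add_mono order_trans[OF smoothing_L1_le[OF net r(1) k] mult_left_mono]) auto
    also have "\<dots> = ennreal e"
      using e' C_ge_1 by (simp add: ennreal_mult'[symmetric] ennreal_plus[symmetric] algebra_simps del: ennreal_plus)
    finally show "(\<integral>\<^sup>+y. ennreal (norm (?S g y - g y)) \<partial>M) \<le> ennreal e" .
  qed (rule \<rho>)
qed

lemma approximable_add:
  fixes g h :: "'a \<Rightarrow> 'b::{banach, second_countable_topology}"
  assumes g: "integrable M g" "approximable Q g" and h: "integrable M h" "approximable Q h"
  shows "approximable Q (\<lambda>y. g y + h y)"
  unfolding approximable_def
proof (intro allI impI)
  fix e :: real assume "0 < e"
  then have e: "0 < e / 2" by simp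
  obtain \<rho> where \<rho>: "\<rho> > 0" "\<And>r E w. 0 < r \<Longrightarrow> r < \<rho> \<Longrightarrow> averaging_net Q r E w \<Longrightarrow>
    (\<integral>\<^sup>+y. ennreal (norm (smoothing r E w g y - g y)) \<partial>M) \<le> ennreal (e / 2)"
    using approximableE[OF g(2) e] by blast
  obtain \<rho>' where \<rho>': "\<rho>' > 0" "\<And>r E w. 0 < r \<Longrightarrow> r < \<rho>' \<Longrightarrow> averaging_net Q r E w \<Longrightarrow>
    (\<integral>\<^sup>+y. ennreal (norm (smoothing r E w h y - h y)) \<partial>M) \<le> ennreal (e / 2)"
    using approximableE[OF h(2) e] by blast
  show "\<exists>\<rho>>0. \<forall>r E w. 0 < r \<longrightarrow> r < \<rho> \<longrightarrow> averaging_net Q r E w \<longrightarrow>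
    (\<integral>\<^sup>+y. ennreal (norm (smoothing r E w (\<lambda>y. g y + h y) y - (g y + h y))) \<partial>M) \<le> ennreal e"
  proof (intro exI[of _ "min \<rho> \<rho>'"] conjI allI impI)
    fix r E w assume r: "0 < r" "r < min \<rho> \<rho>'" and net: "averaging_net Q r E w"
    let ?S = "smoothing r E w"
    note [measurable] = borel_measurable_integrable[OF g(1)] borel_measurable_integrable[OF h(1)]
      measurable_smoothing[OF net, of g] measurable_smoothing[OF net, of h]
    have eq: "?S (\<lambda>y. g y + h y) y - (g y + h y) = (?S g y - g y) + (?S h y - h y)" for y
      by (simp add: smoothing_add[OF g(1) h(1)])
    have "(\<integral>\<^sup>+y. ennreal (norm (?S (\<lambda>y. g y + h y) y - (g y + h y))) \<partial>M)
      \<le> (\<integral>\<^sup>+y. ennreal (norm (?S g y - g y)) \<partial>M) + (\<integral>\<^sup>+y. ennreal (norm (?S h y - h y)) \<partial>M)"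
      unfolding eq by (intro nn_integral_norm_add_le) measurable
    also have "\<dots> \<le> ennreal (e / 2) + ennreal (e / 2)"
      using r net by (intro add_mono \<rho>(2) \<rho>'(2)) auto
    also have "\<dots> = ennreal e" using e by (simp add: ennreal_plus[symmetric] del: ennreal_plus)
    finally show "(\<integral>\<^sup>+y. ennreal (norm (?S (\<lambda>y. g y + h y) y - (g y + h y))) \<partial>M) \<le> ennreal e" .
  qed (use \<rho> \<rho>' in auto)
qed

lemma approximable_uminus:
  fixes g :: "'a \<Rightarrow> 'b::{banach, second_countable_topology}"
  assumes g: "approximable Q g"
  shows "approximable Q (\<lambda>y. - g y)"
proof -
  have "smoothing r E w (\<lambda>y. - g y) y = - smoothing r E w g y" for r E w y
    by (simp add: smoothing_def avg_def set_lebesgue_integral_def sum_negf)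
  then have "smoothing r E w (\<lambda>y. - g y) y - - g y = - (smoothing r E w g y - g y)" for r E w y
    by simp
  then have "norm (smoothing r E w (\<lambda>y. - g y) y - - g y) = norm (smoothing r E w g y - g y)" for r E w y
    by (simp only: norm_minus_cancel)
  then show ?thesis using g by (simp add: approximable_def)
qed

lemma mean_dev_le:
  assumes r: "0 < r" and a: "\<And>z. z \<in> qball d x r \<Longrightarrow> ennreal (norm (g z - c)) \<le> a"
  shows "mean_dev (qball d x r) g c \<le> a"
proof -
  let ?B = "qball d x r"
  have "(\<integral>\<^sup>+z\<in>?B. ennreal (norm (g z - c)) \<partial>M) \<le> (\<integral>\<^sup>+z. a * indicator ?B z \<partial>M)"
    using a by (intro nn_integral_mono) (auto simp: indicator_def)
  also have "\<dots> = a * emeasure M ?B" by (rule nn_integral_cmult_indicator) simp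
  finally have "mean_dev ?B g c \<le> ennreal (1 / measure M ?B) * (a * ennreal (measure M ?B))"
    unfolding mean_dev_def emeasure_qball[OF r] by (rule mult_left_mono) simp
  also have "\<dots> = (ennreal (1 / measure M ?B) * ennreal (measure M ?B)) * a" by (simp only: mult_ac)
  also have "\<dots> = a" using measure_qball_pos[OF r, of x] by (simp add: ennreal_mult'[symmetric])
  finally show ?thesis .
qed

text \<open>
  The points of \<open>U\<close> that have distance at least \<open>4 * K^3 * \<rho>\<close> from the complement form a closed set
  \<open>F \<rho>\<close>. At scales below \<open>\<rho>\<close>, smoothing reproduces the indicator of \<open>U\<close> on \<open>F \<rho>\<close>, and outside \<open>U\<close>
  only the part of the indicator over \<open>U - F \<rho>\<close> is visible. The error is thus bounded by the measure of
  \<open>U - F \<rho>\<close>, which tends to 0. The boundary of \<open>U\<close> may have positive measure, so there is no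
  pointwise convergence to rely on.
\<close>

lemma approximable_open:
  fixes c :: "'b::{banach, second_countable_topology}"
  assumes U: "open U" "U \<subseteq> Q" "emeasure M U < \<infinity>"
  shows "approximable Q (\<lambda>y. indicator U y *\<^sub>R c)"
  unfolding approximable_def
proof (intro allI impI)
  fix e :: real assume e: "0 < e"
  have Um [measurable]: "U \<in> sets M" using U(1) by (simp add: borel)
  define F where "F \<rho> = {y. qball d y (4 * K^3 * \<rho>) \<subseteq> U}" for \<rho>
  have K3: "0 < 4 * K^3" using K_ge_1 by simp
  have F_sets: "F \<rho> \<in> sets M" if "0 < \<rho>" for \<rho>
  proof -
    have "- F \<rho> = (\<Union>z\<in>-U. qball d z (4 * K^3 * \<rho>))"
      using symmetric by (fastforce simp: F_def)
    moreover have "0 < 4 * K^3 * \<rho>" using that K3 by simp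
    ultimately have "open (- F \<rho>)" by (metis open_UN ball_open)
    then have "closed (F \<rho>)" by (simp add: closed_def)
    then show ?thesis by (simp add: borel)
  qed
  have F_sub: "F \<rho> \<subseteq> U" if "0 < \<rho>" for \<rho>
    using that K3 by (auto simp: F_def subset_iff)
  define G where "G n = U - F (1 / Suc n)" for n
  have G_sets: "G n \<in> sets M" for n unfolding G_def using F_sets[of "1 / Suc n"] Um by auto
  have "decseq G"
  proof (rule decseq_SucI)
    fix n
    have "4 * K^3 * (1 / Suc (Suc n)) \<le> 4 * K^3 * (1 / Suc n)"
      using K3 by (intro mult_left_mono) (auto simp: field_simps)
    then have "F (1 / Suc n) \<subseteq> F (1 / Suc (Suc n))" unfolding F_def using qball_mono by blast
    then show "G (Suc n) \<subseteq> G n" by (auto simp: G_def)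
  qed
  moreover have "(\<Inter>n. G n) = {}"
  proof -
    have "\<exists>n. y \<in> F (1 / Suc n)" if yU: "y \<in> U" for y
    proof -
      obtain t where t: "t > 0" "qball d y t \<subseteq> U" using ball_basis[OF U(1) yU] by blast
      obtain n where n: "inverse (real (Suc n)) < t / (4 * K^3)"
        using reals_Archimedean[of "t / (4 * K^3)"] t K3 by auto
      then have "4 * K^3 * (1 / Suc n) \<le> t" using K3 by (simp add: field_simps)
      then have "y \<in> F (1 / Suc n)" unfolding F_def using qball_mono t(2) by blast
      then show ?thesis by blast
    qed
    then show ?thesis by (auto simp: G_def)
  qed
  moreover have "emeasure M (G n) \<noteq> \<infinity>" for n
    using emeasure_mono[of "G n" U M] U(3) Um by (auto simp: G_def top_unique)
  ultimately have lim: "(\<lambda>n. emeasure M (G n)) \<longlonglongrightarrow> 0"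
    using Lim_emeasure_decseq[of G M] G_sets by auto
  define e' where "e' = e / ((C + 1) * (norm c + 1))"
  have e': "0 < e'" unfolding e'_def using e C_ge_1 by (intro divide_pos_pos mult_pos_pos) (auto simp: add_nonneg_pos)
  have "\<forall>\<^sub>F n in sequentially. emeasure M (G n) < ennreal e'"
    using order_tendstoD(2)[OF lim, of "ennreal e'"] e' by simp
  then obtain n where n: "emeasure M (G n) < ennreal e'" by (auto simp: eventually_sequentially)
  define \<rho> where "\<rho> = 1 / real (Suc n)"
  have \<rho>: "0 < \<rho>" by (simp add: \<rho>_def)
  let ?F = "F \<rho>" and ?G = "G n"
  have GF: "?G = U - ?F" by (simp add: G_def \<rho>_def)
  note FU = F_sub[OF \<rho>]
  note [measurable] = F_sets[OF \<rho>] G_sets[of n]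
  let ?g = "\<lambda>y. indicator U y *\<^sub>R c"
  let ?gF = "\<lambda>y. indicator ?F y *\<^sub>R c"
  let ?gG = "\<lambda>y. indicator ?G y *\<^sub>R c"
  have int_sub: "integrable M (\<lambda>y. indicator A y *\<^sub>R c)" if "A \<in> sets M" "A \<subseteq> U" for A
    using emeasure_mono[OF that(2) Um] U(3) that(1)
    by (intro integrable_scaleR_left integrable_real_indicator) auto
  have ig: "integrable M ?g" "integrable M ?gF" "integrable M ?gG"
    using FU by (auto intro!: int_sub simp: GF)
  have split: "?g = (\<lambda>y. ?gF y + ?gG y)" using FU by (auto simp: GF indicator_def fun_eq_iff)
  show "\<exists>\<rho>>0. \<forall>r E w. 0 < r \<longrightarrow> r < \<rho> \<longrightarrow> averaging_net Q r E w \<longrightarrow>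
    (\<integral>\<^sup>+y. ennreal (norm (smoothing r E w ?g y - ?g y)) \<partial>M) \<le> ennreal e"
  proof (intro exI[of _ \<rho>] conjI allI impI \<rho>)
    fix r E w assume r: "0 < r" "r < \<rho>" and net: "averaging_net Q r E w"
    let ?S = "smoothing r E w"
    have rK: "0 < r / (2 * K)" using r K_ge_1 by simp
    have "4 * K^3 * r \<le> 4 * K^3 * \<rho>" using r K3 by (intro mult_left_mono) auto
    note big = qball_mono[OF this]
    have near: "qball d i (r / (2 * K)) \<subseteq> qball d y (4 * K^3 * \<rho>)" if "d i y < 2 * K * r" for i y
      using small_ball_subset(2)[OF r(1) order_refl _ that, of y] r(1) big[of y] by auto
    have pt: "ennreal (norm (?S ?g y - ?g y)) \<le> ennreal (norm (?S ?gG y)) + ennreal (norm c) * indicator ?G y" for y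
    proof (cases "y \<in> U")
      case False
      have "ennreal (norm (?S ?gF y - 0)) \<le> 0"
      proof (rule smoothing_diff_const_le_sup[OF net r(1) ig(2)])
        fix i assume iy: "d i y < 2 * K * r"
        show "mean_dev (qball d i (r / (2 * K))) ?gF 0 \<le> 0"
        proof (rule mean_dev_le[OF rK])
          fix z assume z: "z \<in> qball d i (r / (2 * K))"
          then have "y \<in> qball d z (4 * K^3 * \<rho>)" using near[OF iy] symmetric[of y z] by auto
          then have "z \<notin> ?F" using False unfolding F_def by blast
          then show "ennreal (norm (?gF z - 0)) \<le> 0" by simp
        qed
      qed simp
      then have "?S ?gF y = 0" by simp
      then have "?S ?g y = ?S ?gG y" unfolding split smoothing_add[OF ig(2,3)] by simp
      then show ?thesis using False by (simp add: GF)
    next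
      case yU: True
      then have yQ: "y \<in> Q \<or> c = 0" using U(2) by blast
      show ?thesis
      proof (cases "y \<in> ?F")
        case True
        have "ennreal (norm (?S ?g y - c)) \<le> 0"
        proof (rule smoothing_diff_const_le_sup[OF net r(1) ig(1) yQ])
          fix i assume iy: "d i y < 2 * K * r"
          show "mean_dev (qball d i (r / (2 * K))) ?g c \<le> 0"
          proof (rule mean_dev_le[OF rK])
            fix z assume "z \<in> qball d i (r / (2 * K))"
            then have "z \<in> U" using near[OF iy] True unfolding F_def by blast
            then show "ennreal (norm (?g z - c)) \<le> 0" by simp
          qed
        qed
        then show ?thesis using yU by simp
      next
        case False
        have "ennreal (norm (?S ?g y - c)) \<le> ennreal (norm c)"
          by (rule smoothing_diff_const_le_sup[OF net r(1) ig(1) yQ], rule mean_dev_le[OF rK])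
            (auto simp: indicator_def)
        then show ?thesis using yU False by (simp add: GF add_increasing)
      qed
    qed
    note [measurable] = measurable_smoothing[OF net, of ?gG]
    have "(\<integral>\<^sup>+y. ennreal (norm (?S ?g y - ?g y)) \<partial>M)
        \<le> (\<integral>\<^sup>+y. ennreal (norm (?S ?gG y)) + ennreal (norm c) * indicator ?G y \<partial>M)"
      by (intro nn_integral_mono pt)
    also have "\<dots> = (\<integral>\<^sup>+y. ennreal (norm (?S ?gG y)) \<partial>M) + ennreal (norm c) * emeasure M ?G"
      by (subst nn_integral_add) (auto simp: nn_integral_cmult_indicator)
    also have "\<dots> \<le> ennreal C * (\<integral>\<^sup>+y. ennreal (norm (?gG y)) \<partial>M) + ennreal (norm c) * emeasure M ?G"
      by (intro add_right_mono smoothing_L1_le[OF net r(1) ig(3)])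
    also have "(\<integral>\<^sup>+y. ennreal (norm (?gG y)) \<partial>M) = (\<integral>\<^sup>+y. ennreal (norm c) * indicator ?G y \<partial>M)"
      by (intro nn_integral_cong) (auto simp: indicator_def)
    also have "\<dots> = ennreal (norm c) * emeasure M ?G" by (rule nn_integral_cmult_indicator) simp
    also have "ennreal C * (ennreal (norm c) * emeasure M ?G) + ennreal (norm c) * emeasure M ?G
        = ennreal ((C + 1) * norm c) * emeasure M ?G"
      using C_ge_1 by (simp add: ennreal_plus ennreal_mult' distrib_right mult.assoc)
    also have "\<dots> \<le> ennreal ((C + 1) * (norm c + 1)) * ennreal e'"
      using n C_ge_1 by (intro mult_mono ennreal_leI mult_left_mono) auto
    also have "\<dots> = ennreal e"
      unfolding e'_def using C_ge_1 by (subst ennreal_mult'[symmetric]) (auto simp: add_nonneg_eq_0_iff)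
    finally show "(\<integral>\<^sup>+y. ennreal (norm (?S ?g y - ?g y)) \<partial>M) \<le> ennreal e" .
  qed
qed

text \<open>
  The sets with this property form a Dynkin system that contains the open sets.
\<close>

lemma approximable_indicator:
  fixes c :: "'b::{banach, second_countable_topology}"
  assumes D: "D \<in> sets M" and R: "0 < R" and Q: "qball d x0 R \<subseteq> Q"
  shows "approximable Q (\<lambda>y. indicator (D \<inter> qball d x0 R) y *\<^sub>R c)"
proof -
  let ?U = "qball d x0 R"
  have sets: "sets M = sigma_sets UNIV {S. open S}" by (simp add: borel borel_def)
  have Ufin: "emeasure M ?U < \<infinity>" by (rule ball_finite[OF R])
  have int: "integrable M (\<lambda>y. indicator (A \<inter> ?U) y *\<^sub>R c)" if "A \<in> sets M" for A
    using emeasure_mono[of "A \<inter> ?U" ?U M] Ufin that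
    by (intro integrable_scaleR_left integrable_real_indicator) auto
  have Int: "Int_stable {S::'a set. open S}" by (auto simp: Int_stable_def)
  have "{S::'a set. open S} \<subseteq> Pow UNIV" "D \<in> sigma_sets UNIV {S. open S}" using D sets by auto
  with Int show ?thesis
  proof (induction rule: sigma_sets_induct_disjoint)
    case (basic A)
    have "emeasure M (A \<inter> ?U) \<le> emeasure M ?U" by (intro emeasure_mono) auto
    then show ?case using basic Q Ufin ball_open[OF R] by (intro approximable_open) auto
  next
    case empty
    show ?case using approximable_open[of "{}" Q c] by simp
  next
    case (compl A)
    then have A: "A \<in> sets M" by (simp add: sets)
    have "approximable Q (\<lambda>y. indicator ?U y *\<^sub>R c + - (indicator (A \<inter> ?U) y *\<^sub>R c))"
      using int[OF sets.top] int[OF A] compl(2) approximable_open[OF ball_open[OF R] Q Ufin]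
      by (intro approximable_add approximable_uminus) (auto simp del: mem_qball)
    also have "(\<lambda>y. indicator ?U y *\<^sub>R c + - (indicator (A \<inter> ?U) y *\<^sub>R c))
        = (\<lambda>y. indicator ((UNIV - A) \<inter> ?U) y *\<^sub>R c)"
      by (auto simp: fun_eq_iff indicator_def)
    finally show ?case .
  next
    case (union A)
    have A: "A i \<in> sets M" for i using union(2) by (auto simp: sets)
    let ?D = "\<Union>i. A i" and ?P = "\<lambda>n. \<Union>i<n. A i"
    have D: "?D \<in> sets M" and P: "?P n \<in> sets M" for n using A by auto
    have part: "approximable Q (\<lambda>y. indicator (?P n \<inter> ?U) y *\<^sub>R c)" for n
    proof (induction n)
      case 0
      show ?case using approximable_open[of "{}" Q c] by simp
    next
      case (Suc n)
      have "approximable Q (\<lambda>y. indicator (?P n \<inter> ?U) y *\<^sub>R c + indicator (A n \<inter> ?U) y *\<^sub>R c)"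
        using Suc.IH union(3) by (intro approximable_add int A P)
      also have "(\<lambda>y. indicator (?P n \<inter> ?U) y *\<^sub>R c + indicator (A n \<inter> ?U) y *\<^sub>R c)
          = (\<lambda>y. indicator (?P (Suc n) \<inter> ?U) y *\<^sub>R c)"
      proof
        fix y
        have "y \<notin> ?P n" if "y \<in> A n"
        proof
          assume "y \<in> ?P n"
          then obtain i where "i < n" "y \<in> A i" by blast
          then show False using disjoint_family_onD[OF union(1), of i n] that by auto
        qed
        then show "indicator (?P n \<inter> ?U) y *\<^sub>R c + indicator (A n \<inter> ?U) y *\<^sub>R c
            = indicator (?P (Suc n) \<inter> ?U) y *\<^sub>R c"
          by (cases "y \<in> A n") (auto simp: indicator_def lessThan_Suc)
      qed
      finally show ?case .
    qed
    show ?case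
    proof (rule approximable_by_approximable[OF int[OF D]])
      fix e :: real assume e: "0 < e"
      let ?u = "\<lambda>n y. indicator (?P n \<inter> ?U) y *\<^sub>R c" and ?g = "\<lambda>y. indicator (?D \<inter> ?U) y *\<^sub>R c"
      have "(\<lambda>n. \<integral>\<^sup>+y. ennreal (norm (?g y - ?u n y)) \<partial>M) \<longlonglongrightarrow> 0"
      proof (rule nn_integral_dominated_convergence_norm)
        show "?u n \<in> borel_measurable M" for n using int[OF P] by auto
        show "?g \<in> borel_measurable M" using int[OF D] by auto
        show "(\<lambda>y. norm (?g y)) \<in> borel_measurable M"
          by (rule measurable_compose[OF borel_measurable_integrable[OF int[OF D]] borel_measurable_norm])
        show "AE y in M. norm (?u n y) \<le> norm (?g y)" for n by (auto simp: indicator_def)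
        show "(\<integral>\<^sup>+y. ennreal (norm (?g y)) \<partial>M) < \<infinity>" using int[OF D] by (simp add: integrable_iff_bounded)
        show "AE y in M. (\<lambda>n. ?u n y) \<longlonglongrightarrow> ?g y"
        proof (rule AE_I2)
          fix y
          show "(\<lambda>n. ?u n y) \<longlonglongrightarrow> ?g y"
          proof (cases "y \<in> ?D")
            case True
            then obtain i where i: "y \<in> A i" by blast
            have "\<forall>\<^sub>F n in sequentially. ?u n y = ?g y"
              unfolding eventually_sequentially
              using i by (intro exI[of _ "Suc i"]) (auto simp: indicator_def)
            then show ?thesis by (rule tendsto_eventually)
          qed (auto simp: indicator_def)
        qed
      qed
      then have "\<forall>\<^sub>F n in sequentially. (\<integral>\<^sup>+y. ennreal (norm (?g y - ?u n y)) \<partial>M) < ennreal e"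
        using e by (intro order_tendstoD(2)) auto
      then obtain n where "(\<integral>\<^sup>+y. ennreal (norm (?g y - ?u n y)) \<partial>M) < ennreal e"
        by (auto simp: eventually_sequentially)
      then show "\<exists>h. integrable M h \<and> approximable Q h \<and> (\<integral>\<^sup>+y. ennreal (norm (?g y - h y)) \<partial>M) \<le> ennreal e"
        using int[OF P] part by (intro exI[of _ "?u n"] conjI) auto
    qed
  qed
qed

lemma approximable_integrable:
  fixes g :: "'a \<Rightarrow> 'b::{banach, second_countable_topology}"
  assumes g: "integrable M g" and R: "0 < R" and Q: "qball d x0 R \<subseteq> Q"
  shows "approximable Q (\<lambda>y. indicator (qball d x0 R) y *\<^sub>R g y)"
  using g
proof (induction rule: integrable_induct)
  case (base A c)
  have "(\<lambda>y. indicator (qball d x0 R) y *\<^sub>R indicator A y *\<^sub>R c) = (\<lambda>y. indicator (A \<inter> qball d x0 R) y *\<^sub>R c)"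
    by (auto simp: fun_eq_iff indicator_def)
  then show ?case using approximable_indicator[OF base(1) R Q, of c] by simp
next
  case (add f g)
  have "approximable Q (\<lambda>y. indicator (qball d x0 R) y *\<^sub>R f y + indicator (qball d x0 R) y *\<^sub>R g y)"
    using add by (intro approximable_add integrable_mult_indicator) auto
  then show ?case by (simp add: scaleR_add_right)
next
  case (lim f s)
  let ?U = "qball d x0 R"
  let ?u = "\<lambda>n y. indicator ?U y *\<^sub>R s n y" and ?f = "\<lambda>y. indicator ?U y *\<^sub>R f y"
  have int: "integrable M ?f" "integrable M (?u n)" for n
    using lim(1,4) by (auto intro!: integrable_mult_indicator)
  show ?case
  proof (rule approximable_by_approximable[OF int(1)])
    fix e :: real assume e: "0 < e"
    have "(\<lambda>n. \<integral>\<^sup>+y. ennreal (norm (?f y - ?u n y)) \<partial>M) \<longlonglongrightarrow> 0"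
    proof (rule nn_integral_dominated_convergence_norm)
      show "?u n \<in> borel_measurable M" for n using int(2) by auto
      show "?f \<in> borel_measurable M" using int(1) by auto
      show "(\<lambda>y. 2 * norm (f y)) \<in> borel_measurable M" using lim(4) by auto
      show "AE y in M. norm (?u n y) \<le> 2 * norm (f y)" for n using lim(3) by (auto simp: indicator_def)
      have "integrable M (\<lambda>y. 2 * norm (f y))" using lim(4) by auto
      then have "(\<integral>\<^sup>+y. ennreal (norm (2 * norm (f y))) \<partial>M) < \<infinity>"
        unfolding integrable_iff_bounded by blast
      moreover have "norm (2 * norm v) = 2 * norm v" for v :: 'b by simp
      ultimately show "(\<integral>\<^sup>+y. ennreal (2 * norm (f y)) \<partial>M) < \<infinity>" by (simp only:)
      show "AE y in M. (\<lambda>n. ?u n y) \<longlonglongrightarrow> ?f y"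
        using lim(2) by (intro AE_I2 tendsto_intros) auto
    qed
    then have "\<forall>\<^sub>F n in sequentially. (\<integral>\<^sup>+y. ennreal (norm (?f y - ?u n y)) \<partial>M) < ennreal e"
      using e by (intro order_tendstoD(2)) auto
    then obtain n where "(\<integral>\<^sup>+y. ennreal (norm (?f y - ?u n y)) \<partial>M) < ennreal e"
      by (auto simp: eventually_sequentially)
    then show "\<exists>h. integrable M h \<and> approximable Q h \<and> (\<integral>\<^sup>+y. ennreal (norm (?f y - h y)) \<partial>M) \<le> ennreal e"
      using int(2) lim(5) by (intro exI[of _ "?u n"] conjI) auto
  qed
qed

end

section \<open>Approximation of functions of bounded mean oscillation\<close>

text \<open>
  Truncation at height \<open>N\<close> is the metric projection onto a ball. Since it is 1-Lipschitz, it does not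
  increase oscillations.
\<close>

lemma truncation:
  fixes v w :: "'b::euclidean_space"
  assumes "0 < N"
  shows "norm (closest_point (cball 0 N) v) \<le> N" "norm (closest_point (cball 0 N) v) \<le> norm v"
    "norm v \<le> N \<Longrightarrow> closest_point (cball 0 N) v = v"
    "norm (closest_point (cball 0 N) v - closest_point (cball 0 N) w) \<le> norm (v - w)"
proof -
  have ne: "cball (0::'b) N \<noteq> {}" using assms by simp
  show "norm (closest_point (cball 0 N) v) \<le> N"
    using closest_point_in_set[OF closed_cball ne, of v] by simp
  show *: "norm (closest_point (cball 0 N) v - closest_point (cball 0 N) w) \<le> norm (v - w)" for v w :: 'b
    using closest_point_lipschitz[OF convex_cball closed_cball ne, of v w] by (simp add: dist_norm)
  have "closest_point (cball (0::'b) N) 0 = 0" using assms by (intro closest_point_self) auto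
  then show "norm (closest_point (cball 0 N) v) \<le> norm v" using *[of v 0] by simp
  show "norm v \<le> N \<Longrightarrow> closest_point (cball 0 N) v = v" by (intro closest_point_self) simp
qed

context homogeneous_constants
begin

lemma BMO_borel_measurable:
  fixes f :: "'a \<Rightarrow> 'b::euclidean_space"
  assumes "f \<in> BMO d M"
  shows "f \<in> borel_measurable M"
proof -
  fix x0 :: 'a
  let ?s = "\<lambda>n y. indicator (qball d x0 (real (Suc n))) y *\<^sub>R f y"
  show ?thesis
  proof (rule borel_measurable_LIMSEQ_metric)
    fix n
    have "set_integrable M (qball d x0 (real (Suc n))) f" using assms by (auto simp: BMO_def)
    then show "?s n \<in> borel_measurable M" by (auto simp: set_integrable_def)
  next
    fix y
    obtain n0 where n0: "d x0 y < real n0" using reals_Archimedean2 by blast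
    have "\<forall>\<^sub>F n in sequentially. ?s n y = f y"
      unfolding eventually_sequentially using n0 by (intro exI[of _ n0]) auto
    then show "(\<lambda>n. ?s n y) \<longlonglongrightarrow> f y" by (rule tendsto_eventually)
  qed
qed

text \<open>
  A product rule for oscillations: truncation bounds the factor that multiplies the oscillation of the
  cutoff, so the bound is useful when \<open>e\<close> is of size \<open>b / N\<close>.
\<close>

lemma osc_bounded_cutoff_truncation:
  fixes f :: "'a \<Rightarrow> 'b::euclidean_space"
  assumes N: "0 < N"
    and [measurable]: "f \<in> borel_measurable M" "\<eta> \<in> borel_measurable M"
    and \<eta>: "\<And>y. 0 \<le> \<eta> y" "\<And>y. \<eta> y \<le> 1"
    and osc: "osc_bounded d M \<eta> e" "osc_bounded d M f b"
  shows "osc_bounded d M (\<lambda>y. \<eta> y *\<^sub>R closest_point (cball 0 N) (f y)) (ennreal N * e + b)"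
  unfolding osc_bounded_def
proof (intro allI impI)
  fix x and r :: real assume r: "0 < r"
  let ?B = "qball d x r" let ?T = "closest_point (cball (0::'b) N)"
  obtain c where c: "(\<integral>\<^sup>+y\<in>?B. ennreal (norm (\<eta> y - c)) \<partial>M) \<le> e * emeasure M ?B"
    using osc_boundedE[OF osc(1) r] by blast
  obtain a where a: "(\<integral>\<^sup>+y\<in>?B. ennreal (norm (f y - a)) \<partial>M) \<le> b * emeasure M ?B"
    using osc_boundedE[OF osc(2) r] by blast
  have pt: "norm (\<eta> y *\<^sub>R ?T (f y) - c *\<^sub>R ?T a) \<le> N * norm (\<eta> y - c) + norm (f y - a)" for y
  proof -
    have "\<eta> y *\<^sub>R ?T (f y) - c *\<^sub>R ?T a = (\<eta> y - c) *\<^sub>R ?T a + \<eta> y *\<^sub>R (?T (f y) - ?T a)"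
      by (simp add: algebra_simps)
    then have "norm (\<eta> y *\<^sub>R ?T (f y) - c *\<^sub>R ?T a)
        \<le> norm ((\<eta> y - c) *\<^sub>R ?T a) + norm (\<eta> y *\<^sub>R (?T (f y) - ?T a))"
      by (metis norm_triangle_ineq)
    also have "\<dots> = norm (?T a) * norm (\<eta> y - c) + \<eta> y * norm (?T (f y) - ?T a)"
      using \<eta>(1) by simp
    also have "\<dots> \<le> N * norm (\<eta> y - c) + 1 * norm (f y - a)"
      using \<eta> truncation[OF N] N by (intro add_mono mult_mono) auto
    finally show ?thesis by simp
  qed
  have "(\<integral>\<^sup>+y\<in>?B. ennreal (norm (\<eta> y *\<^sub>R ?T (f y) - c *\<^sub>R ?T a)) \<partial>M)
    \<le> (\<integral>\<^sup>+y. ennreal N * (ennreal (norm (\<eta> y - c)) * indicator ?B y) + ennreal (norm (f y - a)) * indicator ?B y \<partial>M)"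
  proof (rule nn_integral_mono)
    fix y
    have "ennreal (norm (\<eta> y *\<^sub>R ?T (f y) - c *\<^sub>R ?T a)) \<le> ennreal N * ennreal (norm (\<eta> y - c)) + ennreal (norm (f y - a))"
      using ennreal_leI[OF pt[of y]] N by (simp add: ennreal_plus ennreal_mult')
    then show "ennreal (norm (\<eta> y *\<^sub>R ?T (f y) - c *\<^sub>R ?T a)) * indicator ?B y
      \<le> ennreal N * (ennreal (norm (\<eta> y - c)) * indicator ?B y) + ennreal (norm (f y - a)) * indicator ?B y"
      by (auto simp: indicator_def)
  qed
  also have "\<dots> = ennreal N * (\<integral>\<^sup>+y\<in>?B. ennreal (norm (\<eta> y - c)) \<partial>M) + (\<integral>\<^sup>+y\<in>?B. ennreal (norm (f y - a)) \<partial>M)"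
    by (subst nn_integral_add) (auto simp: nn_integral_cmult)
  also have "\<dots> \<le> ennreal N * (e * emeasure M ?B) + b * emeasure M ?B"
    by (intro add_mono mult_left_mono c a) auto
  also have "\<dots> = (ennreal N * e + b) * emeasure M ?B" by (simp add: distrib_right mult.assoc)
  finally show "\<exists>c. (\<integral>\<^sup>+y\<in>?B. ennreal (norm (\<eta> y *\<^sub>R ?T (f y) - c)) \<partial>M) \<le> (ennreal N * e + b) * emeasure M ?B"
    by blast
qed

lemma mean_dev_le_restricted_maximal:
  assumes "0 < r" "r < 1" and "\<And>y. norm (g y) \<le> norm (f y)"
  shows "mean_dev (qball d x r) g 0 \<le> restricted_maximal d M f x"
proof -
  let ?B = "qball d x r"
  have m: "0 < measure M ?B" by (rule measure_qball_pos[OF assms(1)])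
  have "mean_dev ?B g 0 \<le> ennreal (1 / measure M ?B) * (\<integral>\<^sup>+y\<in>?B. ennreal (norm (f y)) \<partial>M)"
    unfolding mean_dev_def using assms(3)
    by (intro mult_left_mono nn_integral_mono) (auto simp: indicator_def intro!: ennreal_leI)
  also have "\<dots> = (\<integral>\<^sup>+y\<in>?B. ennreal (norm (f y)) \<partial>M) / emeasure M ?B"
    using m by (simp add: emeasure_qball[OF assms(1)] divide_ennreal_def inverse_ennreal mult.commute inverse_eq_divide)
  also have "\<dots> \<le> restricted_maximal d M f x"
    unfolding restricted_maximal_def using assms by (intro SUP_upper) auto
  finally show ?thesis .
qed

text \<open>
  One member of the sequence. The cutoff is chosen after the height \<open>N\<close> of the truncation, with
  oscillation \<open>\<parallel>f\<parallel> / N\<close>, and the scale of the smoothing after both; since smoothing is bounded in BMO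
  uniformly in the scale, the latter can be taken as small as the \<open>L\<^sup>1\<close> error \<open>e\<close> demands.
\<close>

lemma ex_approximation:
  fixes f :: "'a \<Rightarrow> 'b::euclidean_space"
  assumes f: "f \<in> BMO d M" and nz: "bmo_norm d M f \<noteq> 0" and N: "0 < N" and e: "0 < e"
  shows "\<exists>F. bounded (range F) \<and> continuous_on UNIV F \<and> boundedly_supported d F \<and>
    bmo_norm d M F \<le> ennreal (4 * (C * (C + 1))) * bmo_norm d M f \<and>
    (\<forall>x. ennreal (norm (F x)) \<le> ennreal C * restricted_maximal d M f x) \<and>
    (\<exists>g\<in>borel_measurable M. (\<forall>y. d x0 y < N \<longrightarrow> norm (f y) \<le> N \<longrightarrow> g y = f y) \<and>
      (\<integral>\<^sup>+y. ennreal (norm (F y - g y)) \<partial>M) \<le> ennreal e)"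
proof -
  note fm [measurable] = BMO_borel_measurable[OF f]
  obtain b where b: "bmo_norm d M f = ennreal b" "0 \<le> b"
    using f by (cases "bmo_norm d M f") (auto simp: BMO_def)
  then have b0: "0 < b" using nz by (cases "b = 0") auto
  obtain \<eta> :: "'a \<Rightarrow> real" and R where \<eta> [measurable]: "\<eta> \<in> borel_measurable M"
    and \<eta>01: "\<And>y. 0 \<le> \<eta> y" "\<And>y. \<eta> y \<le> 1" and \<eta>1: "\<And>y. y \<in> qball d x0 N \<Longrightarrow> \<eta> y = 1"
    and R: "0 < R" and \<eta>0: "\<And>y. y \<notin> qball d x0 R \<Longrightarrow> \<eta> y = 0"
    and \<eta>osc: "osc_bounded d M \<eta> (ennreal (b / N))"
    using ex_slow_cutoff[OF N, of "b / N" x0] b0 N by (auto; metis)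
  let ?T = "closest_point (cball (0::'b) N)"
  define g where "g y = \<eta> y *\<^sub>R ?T (f y)" for y
  have Tm: "?T \<in> borel_measurable borel"
    using N by (intro borel_measurable_continuous_onI continuous_on_closest_point) auto
  have gm [measurable]: "g \<in> borel_measurable M"
    unfolding g_def using measurable_compose[OF fm Tm] by measurable
  have g_f: "norm (g y) \<le> norm (f y)" and g_N: "norm (g y) \<le> N" for y
  proof -
    have "norm (g y) \<le> norm (?T (f y))" unfolding g_def using \<eta>01[of y] by (simp add: mult_left_le_one_le)
    then show "norm (g y) \<le> norm (f y)" "norm (g y) \<le> N" using truncation(1,2)[OF N, of "f y"] by linarith+
  qed
  have supp: "g y = 0" if "y \<notin> qball d x0 R" for y using \<eta>0[OF that] by (simp add: g_def)
  have eq: "g y = f y" if "d x0 y < N" "norm (f y) \<le> N" for y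
    using \<eta>1[of y] that truncation(3)[OF N] by (simp add: g_def)
  have "(\<integral>\<^sup>+y. ennreal (norm (g y)) \<partial>M) \<le> (\<integral>\<^sup>+y. ennreal N * indicator (qball d x0 R) y \<partial>M)"
    using supp g_N by (intro nn_integral_mono) (auto simp: indicator_def intro!: ennreal_leI)
  also have "\<dots> = ennreal N * emeasure M (qball d x0 R)" by (rule nn_integral_cmult_indicator) simp
  also have "\<dots> < \<infinity>" unfolding emeasure_qball[OF R] by (simp add: ennreal_mult_less_top)
  finally have g: "integrable M g" by (intro integrableI_bounded) auto
  have "osc_bounded d M g (ennreal N * ennreal (b / N) + ennreal b)"
    unfolding g_def using osc_bounded_bmo_norm[of f] b(1)
    by (intro osc_bounded_cutoff_truncation N \<eta>01 \<eta>osc) (auto simp: fm \<eta>)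
  also have "ennreal N * ennreal (b / N) + ennreal b = ennreal (2 * b)"
    using N b0 by (simp add: ennreal_mult'[symmetric] ennreal_plus[symmetric] del: ennreal_plus)
  finally have osc: "osc_bounded d M g (ennreal (2 * b))" .
  define Q where "Q = qball d x0 (K^3 * (R + 5))"
  have K3: "1 \<le> K^3" by (rule one_le_power[OF K_ge_1])
  have "1 * R \<le> K^3 * (R + 5)" using K3 R K_ge_1 by (intro mult_mono) auto
  then have RQ: "qball d x0 R \<subseteq> Q" unfolding Q_def by (intro qball_mono) simp
  have "(\<lambda>y. indicator (qball d x0 R) y *\<^sub>R g y) = g" using supp by (auto simp: fun_eq_iff indicator_def)
  then have "approximable Q g" using approximable_integrable[OF g R RQ] by simp
  then obtain \<rho> where \<rho>: "\<rho> > 0" "\<And>r E w. 0 < r \<Longrightarrow> r < \<rho> \<Longrightarrow> averaging_net Q r E w \<Longrightarrow>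
    (\<integral>\<^sup>+y. ennreal (norm (smoothing r E w g y - g y)) \<partial>M) \<le> ennreal e"
    using approximableE[OF _ e] by blast
  \<comment> \<open>The second bound keeps the radius \<open>4 * K^3 * r\<close> of the averages below 1, as the restricted maximal
    function demands.\<close>
  define r where "r = min (\<rho> / 2) (1 / (8 * K^3))"
  have r: "0 < r" "r < \<rho>" "4 * K^3 * r < 1" "r \<le> 1"
  proof -
    show "0 < r" "r < \<rho>" using \<rho>(1) K_ge_1 by (auto simp: r_def)
    have "4 * K^3 * r \<le> 4 * K^3 * (1 / (8 * K^3))" using K_ge_1 by (intro mult_left_mono) (auto simp: r_def)
    also have "\<dots> = 1 / 2" using K_ge_1 by (simp add: field_simps)
    finally show *: "4 * K^3 * r < 1" by simp
    have "1 * r \<le> 4 * K^3 * r" using K3 \<open>0 < r\<close> by (intro mult_right_mono) auto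
    then show "r \<le> 1" using * by simp
  qed
  have "0 < K^3 * (R + 5)" using K_ge_1 R by simp
  then obtain E w where net: "averaging_net Q r E w"
    unfolding Q_def using ex_averaging_net[OF r(1)] by blast
  let ?F = "smoothing r E w g"
  have FL1: "(\<integral>\<^sup>+y. ennreal (norm (?F y)) \<partial>M) < \<infinity>"
    by (rule le_less_trans[OF smoothing_L1_le[OF net r(1) g]])
      (use g in \<open>simp add: integrable_iff_bounded ennreal_mult_less_top\<close>)
  have F: "integrable M ?F" using measurable_smoothing[OF net] FL1 by (intro integrableI_bounded) auto
  show ?thesis
  proof (intro exI[of _ ?F] conjI allI bexI[of _ g] impI eq)
    show "bounded (range ?F)" by (rule bounded_smoothing[OF net])
    show "continuous_on UNIV ?F" by (rule continuous_smoothing[OF net])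
    have "0 < K^2 * (R + 3)" using K_ge_1 R by simp
    moreover have "d x0 y < K^2 * (R + 3)" if "?F y \<noteq> 0" for y
      by (rule smoothing_support[OF net r(1,4) supp that])
    then have "\<forall>y. y \<notin> qball d x0 (K^2 * (R + 3)) \<longrightarrow> ?F y = 0" by auto
    ultimately show "boundedly_supported d ?F" unfolding boundedly_supported_def by blast
    have "bmo_norm d M ?F \<le> 2 * (ennreal (C * (C + 1)) * ennreal (2 * b))"
      using osc_bounded_smoothing[OF net[unfolded Q_def] r(1,4) R g supp osc] by (rule bmo_norm_le[OF F])
    also have "\<dots> = ennreal (4 * (C * (C + 1))) * bmo_norm d M f"
    proof -
      have "2 * (ennreal (C * (C + 1)) * ennreal (2 * b)) = ennreal 2 * (ennreal (C * (C + 1)) * ennreal (2 * b))"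
        by simp
      also have "\<dots> = ennreal (4 * (C * (C + 1)) * b)"
        using C_ge_1 b0 by (simp add: ennreal_mult'[symmetric] mult_ac del: ennreal_numeral)
      finally show ?thesis using C_ge_1 b by (simp add: ennreal_mult')
    qed
    finally show "bmo_norm d M ?F \<le> ennreal (4 * (C * (C + 1))) * bmo_norm d M f" .
    show "ennreal (norm (?F x)) \<le> ennreal C * restricted_maximal d M f x" for x
    proof -
      have "ennreal (norm (?F x - 0)) \<le> ennreal C * mean_dev (qball d x (4 * K^3 * r)) g 0"
        using r(1) by (intro smoothing_diff_const_le_ball[OF net r(1) g]) auto
      also have "\<dots> \<le> ennreal C * restricted_maximal d M f x"
        using r K_ge_1 g_f by (intro mult_left_mono mean_dev_le_restricted_maximal) auto
      finally show ?thesis by simp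
    qed
    show "(\<integral>\<^sup>+y. ennreal (norm (?F y - g y)) \<partial>M) \<le> ennreal e" by (rule \<rho>(2)[OF r(1,2) net])
  qed (auto simp: gm)
qed

text \<open>
  The norms of the errors have a sum with finite integral, so they are summable almost everywhere and
  tend to 0 there. The scales of smoothing may depend on \<open>f\<close>, which makes it possible to prescribe
  geometrically decreasing errors.
\<close>

lemma AE_tendsto_of_summable_L1:
  fixes F g :: "nat \<Rightarrow> 'a \<Rightarrow> 'b::{banach, second_countable_topology}"
  assumes [measurable]: "\<And>j. F j \<in> borel_measurable M" "\<And>j. g j \<in> borel_measurable M"
    and L1: "\<And>j. (\<integral>\<^sup>+y. ennreal (norm (F j y - g j y)) \<partial>M) \<le> ennreal ((1 / 2)^j)"
    and g: "\<And>y. \<forall>\<^sub>F j in sequentially. g j y = f y"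
  shows "AE y in M. (\<lambda>j. F j y) \<longlonglongrightarrow> f y"
proof -
  have "(\<integral>\<^sup>+y. (\<Sum>j. ennreal (norm (F j y - g j y))) \<partial>M) = (\<Sum>j. \<integral>\<^sup>+y. ennreal (norm (F j y - g j y)) \<partial>M)"
    by (rule nn_integral_suminf) auto
  also have "\<dots> \<le> (\<Sum>j. ennreal ((1 / 2)^j))" by (intro suminf_le L1) auto
  also have "\<dots> = ennreal (\<Sum>j. (1 / 2)^j)" by (rule suminf_ennreal2) (auto intro: summable_geometric)
  also have "\<dots> < \<infinity>" by simp
  finally have "AE y in M. (\<Sum>j. ennreal (norm (F j y - g j y))) \<noteq> \<infinity>"
    by (intro nn_integral_PInf_AE) auto
  then show ?thesis
  proof eventually_elim
    case (elim y)
    then have "summable (\<lambda>j. norm (F j y - g j y))" by (intro summable_suminf_not_top) auto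
    then have "(\<lambda>j. norm (F j y - g j y)) \<longlonglongrightarrow> 0" by (rule summable_LIMSEQ_zero)
    then have "(\<lambda>j. F j y - g j y) \<longlonglongrightarrow> 0" by (rule tendsto_norm_zero_cancel)
    moreover have "(\<lambda>j. g j y) \<longlonglongrightarrow> f y" by (rule tendsto_eventually[OF g])
    ultimately have "(\<lambda>j. (F j y - g j y) + g j y) \<longlonglongrightarrow> 0 + f y" by (rule tendsto_add)
    then show ?case by simp
  qed
qed

lemma bmo_norm_const:
  fixes c :: "'b::{banach, second_countable_topology}"
  shows "bmo_norm d M (\<lambda>y. c) = 0"
proof -
  have "avg M (qball d x r) (\<lambda>y. c) = c" if "0 < r" for x r
    using measure_qball_pos[OF that, of x] ball_finite[OF that, of x]
    by (simp add: avg_def set_lebesgue_integral_def)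
  then have "bmo_norm d M (\<lambda>y. c) \<le> 0" unfolding bmo_norm_def by (intro SUP_least) simp
  then show ?thesis by simp
qed

text \<open>
  On each ball around \<open>x0\<close> the function agrees almost everywhere with a constant; the constants agree
  with each other because the smallest ball is not a null set.
\<close>

lemma bmo_norm_zero_imp_AE_const:
  fixes f :: "'a \<Rightarrow> 'b::euclidean_space"
  assumes f: "f \<in> BMO d M" and z: "bmo_norm d M f = 0"
  shows "\<exists>c. AE y in M. f y = c"
proof -
  note fm [measurable] = BMO_borel_measurable[OF f]
  fix x0 :: 'a
  let ?B = "\<lambda>n. qball d x0 (real (Suc n))"
  have "\<exists>c. AE y in M. y \<in> ?B n \<longrightarrow> f y = c" for n
  proof -
    have osc: "osc_bounded d M f 0" using osc_bounded_bmo_norm[of f] z by simp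
    obtain c where "(\<integral>\<^sup>+y\<in>?B n. ennreal (norm (f y - c)) \<partial>M) \<le> 0 * emeasure M (?B n)"
      by (rule osc_boundedE[OF osc, of "real (Suc n)" x0]) auto
    then have "(\<integral>\<^sup>+y\<in>?B n. ennreal (norm (f y - c)) \<partial>M) = 0" by simp
    then have "AE y in M. ennreal (norm (f y - c)) * indicator (?B n) y = 0"
      by (subst (asm) nn_integral_0_iff_AE) auto
    then have "AE y in M. y \<in> ?B n \<longrightarrow> f y = c" by eventually_elim (auto simp: indicator_def split: if_splits)
    then show ?thesis by blast
  qed
  then obtain c where c: "\<And>n. AE y in M. y \<in> ?B n \<longrightarrow> f y = c n" by metis
  have const: "c n = c 0" for n
  proof (rule ccontr)
    assume ne: "c n \<noteq> c 0"
    from c[of n] c[of 0] have "AE y in M. y \<notin> ?B 0" by eventually_elim (use ne in auto)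
    then have "?B 0 \<in> null_sets M" by (simp add: AE_iff_null_sets)
    then show False using ball_positive[of "real (Suc 0)" x0] by (simp add: null_sets_def)
  qed
  have "AE y in M. \<forall>n. y \<in> ?B n \<longrightarrow> f y = c n" using c by (simp only: AE_all_countable) blast
  then have "AE y in M. f y = c 0"
  proof eventually_elim
    case (elim y)
    obtain n where "d x0 y < real n" using reals_Archimedean2 by blast
    then have "y \<in> ?B n" by simp
    then have "f y = c n" using elim by blast
    then show ?case using const[of n] by simp
  qed
  then show ?thesis by blast
qed

end

theorem proposition6p1:
  fixes d :: "'a::topological_space \<Rightarrow> 'a \<Rightarrow> real"
    and M :: "'a measure"
  assumes "homogeneous_type d M"
  shows "\<exists>a1 a2 :: real. 0 < a1 \<and> 0 < a2 \<and>
    (\<forall>f :: 'a \<Rightarrow> 'b::{real_normed_field, euclidean_space}.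
      f \<in> BMO d M \<longrightarrow> nondegenerate d M f \<longrightarrow>
      (\<exists>fj :: nat \<Rightarrow> 'a \<Rightarrow> 'b.
        (\<forall>j. bounded (range (fj j)) \<and> continuous_on UNIV (fj j) \<and> boundedly_supported d (fj j)) \<and>
        (\<forall>j. bmo_norm d M (fj j) \<le> ennreal a1 * bmo_norm d M f) \<and>
        (\<forall>j x. ennreal (norm (fj j x)) \<le> ennreal a2 * restricted_maximal d M f x) \<and>
        (AE x in M. (\<lambda>j. fj j x) \<longlonglongrightarrow> f x)))"
proof -
  interpret homogeneous_type d M by fact
  obtain K C where "homogeneous_constants d M K C" using ex_constants by blast
  then interpret homogeneous_constants d M K C .
  show ?thesis
  proof (rule exI[of _ "4 * (C * (C + 1))"], rule exI[of _ C], intro conjI allI impI)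
    show "0 < 4 * (C * (C + 1))" "0 < C" using C_ge_1 by auto
    fix f :: "'a \<Rightarrow> 'b"
    assume f: "f \<in> BMO d M" and nd: "nondegenerate d M f"
    show "\<exists>fj :: nat \<Rightarrow> 'a \<Rightarrow> 'b.
        (\<forall>j. bounded (range (fj j)) \<and> continuous_on UNIV (fj j) \<and> boundedly_supported d (fj j)) \<and>
        (\<forall>j. bmo_norm d M (fj j) \<le> ennreal (4 * (C * (C + 1))) * bmo_norm d M f) \<and>
        (\<forall>j x. ennreal (norm (fj j x)) \<le> ennreal C * restricted_maximal d M f x) \<and>
        (AE x in M. (\<lambda>j. fj j x) \<longlonglongrightarrow> f x)"
    proof (cases "bmo_norm d M f = 0")
      case True
      obtain c where c: "AE y in M. f y = c" using bmo_norm_zero_imp_AE_const[OF f True] by blast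
      \<comment> \<open>Here \<open>f\<close> is almost everywhere constant and a cutoff would have to have oscillation 0. Nondegeneracy
        makes the constant itself an admissible approximation.\<close>
      have bs: "boundedly_supported d (\<lambda>y. c)"
      proof (cases "c = 0")
        case True
        then show ?thesis unfolding boundedly_supported_def by (auto intro!: exI[of _ 1])
      next
        case False
        then obtain x r where xr: "0 < r" "qball d x r = UNIV" using nd c unfolding nondegenerate_def by blast
        then show ?thesis unfolding boundedly_supported_def by (intro exI[of _ x] exI[of _ r]) simp
      qed
      have mx: "ennreal (norm c) \<le> ennreal C * restricted_maximal d M f x" for x
      proof -
        let ?B = "qball d x (1/2)"
        have r: "(0::real) < 1 / 2" by simp
        have m: "0 < measure M ?B" by (rule measure_qball_pos[OF r])
        have "(\<integral>\<^sup>+y\<in>?B. ennreal (norm (f y)) \<partial>M) = (\<integral>\<^sup>+y. ennreal (norm c) * indicator ?B y \<partial>M)"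
          using c by (intro nn_integral_cong_AE) (auto elim!: eventually_mono)
        also have "\<dots> = ennreal (norm c) * emeasure M ?B" by (rule nn_integral_cmult_indicator) simp
        finally have "mean_dev ?B f 0 = (ennreal (1 / measure M ?B) * ennreal (measure M ?B)) * ennreal (norm c)"
          unfolding mean_dev_def emeasure_qball[OF r] by (simp only: diff_zero mult_ac)
        also have "\<dots> = ennreal (norm c)" using m by (simp add: ennreal_mult'[symmetric])
        finally have "ennreal (norm c) \<le> restricted_maximal d M f x"
          using mean_dev_le_restricted_maximal[of "1/2" f f x] by simp
        also have "\<dots> \<le> ennreal C * restricted_maximal d M f x"
          using mult_right_mono[OF ennreal_leI[OF C_ge_1], of "restricted_maximal d M f x"] by simp
        finally show ?thesis .
      qed
      show ?thesis
      proof (rule exI[of _ "\<lambda>j y. c"], intro conjI allI)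
        show "bounded (range (\<lambda>y::'a. c))" by simp
        show "AE x in M. (\<lambda>j::nat. c) \<longlonglongrightarrow> f x" using c by eventually_elim simp
      qed (simp_all add: bs mx bmo_norm_const)
    next
      case False
      fix x0 :: 'a
      have "\<forall>j. \<exists>F. bounded (range F) \<and> continuous_on UNIV F \<and> boundedly_supported d F \<and>
        bmo_norm d M F \<le> ennreal (4 * (C * (C + 1))) * bmo_norm d M f \<and>
        (\<forall>x. ennreal (norm (F x)) \<le> ennreal C * restricted_maximal d M f x) \<and>
        (\<exists>g\<in>borel_measurable M. (\<forall>y. d x0 y < real (Suc j) \<longrightarrow> norm (f y) \<le> real (Suc j) \<longrightarrow> g y = f y) \<and>
          (\<integral>\<^sup>+y. ennreal (norm (F y - g y)) \<partial>M) \<le> ennreal ((1 / 2)^j))"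
        by (intro allI ex_approximation f False) auto
      then have "\<exists>F. \<forall>j. bounded (range (F j)) \<and> continuous_on UNIV (F j) \<and> boundedly_supported d (F j) \<and>
        bmo_norm d M (F j) \<le> ennreal (4 * (C * (C + 1))) * bmo_norm d M f \<and>
        (\<forall>x. ennreal (norm (F j x)) \<le> ennreal C * restricted_maximal d M f x) \<and>
        (\<exists>g\<in>borel_measurable M. (\<forall>y. d x0 y < real (Suc j) \<longrightarrow> norm (f y) \<le> real (Suc j) \<longrightarrow> g y = f y) \<and>
          (\<integral>\<^sup>+y. ennreal (norm (F j y - g y)) \<partial>M) \<le> ennreal ((1 / 2)^j))"
        by (rule choice)
      then obtain F where F: "\<And>j. bounded (range (F j))" "\<And>j. continuous_on UNIV (F j)"
          "\<And>j. boundedly_supported d (F j)"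
          "\<And>j. bmo_norm d M (F j) \<le> ennreal (4 * (C * (C + 1))) * bmo_norm d M f"
          "\<And>j x. ennreal (norm (F j x)) \<le> ennreal C * restricted_maximal d M f x"
        and ex_g: "\<And>j. \<exists>g\<in>borel_measurable M. (\<forall>y. d x0 y < real (Suc j) \<longrightarrow> norm (f y) \<le> real (Suc j) \<longrightarrow> g y = f y) \<and>
          (\<integral>\<^sup>+y. ennreal (norm (F j y - g y)) \<partial>M) \<le> ennreal ((1 / 2)^j)"
        by blast
      then obtain g where g: "\<And>j. g j \<in> borel_measurable M"
          "\<And>j y. d x0 y < real (Suc j) \<Longrightarrow> norm (f y) \<le> real (Suc j) \<Longrightarrow> g j y = f y"
          "\<And>j. (\<integral>\<^sup>+y. ennreal (norm (F j y - g j y)) \<partial>M) \<le> ennreal ((1 / 2)^j)"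
        by metis
      have "\<forall>\<^sub>F j in sequentially. g j y = f y" for y
      proof -
        obtain n where "max (d x0 y) (norm (f y)) < real n" using reals_Archimedean2 by blast
        then have "g j y = f y" if "n \<le> j" for j using that by (intro g(2)) auto
        then show ?thesis unfolding eventually_sequentially by blast
      qed
      then have "AE x in M. (\<lambda>j. F j x) \<longlonglongrightarrow> f x"
        by (rule AE_tendsto_of_summable_L1[of F g, OF continuous_borel_measurable[OF F(2)] g(1,3)])
      then show ?thesis by (intro exI[of _ F] conjI allI F)
    qed
  qed
qed

end
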